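(* Let $\mathscr{H}$ be a complex Hilbert space, let $A,B\in\mathbb{B}(\mathscr{H})$ be $G_1$ operators with $\sigma(A)\cup\sigma(B)\subset\mathbb{D}$, and let $f\in\mathfrak{A}$. Then for every $X\in\mathbb{B}(\mathscr{H})$, $$w\big(f(A)X\bar f(B)-f(B)X\bar f(A)\big)\le \frac{2}{d_Ad_B}\Big[2w(X)+w(AXB^*+BXA^* )+w(AXB^*-BXA^* )\Big]$$ and $$w\big(f(A)X\bar f(B)+2X+f(B)X\bar f(A)\big)\le \frac{2}{d_Ad_B}\Big[2w(X)+w(AXB^*+BXA^* )+w(AXB^*-BXA^* )\Big].$$
   Context: $\mathbb{B}(\mathscr{H})$ is the algebra of all bounded linear operators on the complex Hilbert space $(\mathscr{H},\langle\cdot,\cdot\rangle)$, with identity $I$; $\|\cdot\|$ is the operator norm, and a scalar $z$ stands for $zI$. The numerical radius of $A\in\mathbb{B}(\mathscr{H})$ is $w(A)=\sup\{|\langle Ax,x\rangle| : x\in\mathscr{H},\ \|x\|=1\}$. The operator $A$ is called a $G_1$ operator if $\|(z-A)^{-1}\|=\frac{1}{\mathrm{dist}(z,\sigma(A))}$ for all $z\in\mathbb{C}$ not in the spectrum $\sigma(A)$. $\mathbb{D}=\{z\in\mathbb{C}:|z|<1\}$, $\partial\mathbb{D}$ is its boundary, and $d_A=\mathrm{dist}(\partial\mathbb{D},\sigma(A))$ (similarly $d_B$). $\mathfrak{A}$ is the set of analytic functions $f:\mathbb{D}\to\mathbb{C}$ with $\mathrm{Re}(f)>0$ on $\mathbb{D}$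 and $f(0)=1$. For $f$ analytic on an open neighborhood $\Omega$ of $\sigma(A)$, $f(A)=\frac{1}{2\pi i}\int_C f(z)(z-A)^{-1}\,dz$ (Riesz-Dunford integral), where $C$ is a positively oriented simple closed rectifiable contour surrounding $\sigma(A)$ in $\Omega$. $\bar f$ is the conjugate function of $f$, and $\bar f(A)=(f(A))^*$ (similarly for $B$). *)

theory Defs
  imports "HOL-Complex_Analysis.Complex_Analysis"
begin

section \<open>Complex Hilbert spaces\<close>

class scaleC = scaleR +
  fixes scaleC :: "complex \<Rightarrow> 'a \<Rightarrow> 'a" (infixr \<open>*\<^sub>C\<close> 75)
  assumes scaleR_scaleC: "r *\<^sub>R x = complex_of_real r *\<^sub>C x"

class complex_vector = scaleC + ab_group_add +
  assumes scaleC_add_right: "a *\<^sub>C (x + y) = a *\<^sub>C x + a *\<^sub>C y"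
    and scaleC_add_left: "(a + b) *\<^sub>C x = a *\<^sub>C x + b *\<^sub>C x"
    and scaleC_scaleC [simp]: "a *\<^sub>C (b *\<^sub>C x) = (a * b) *\<^sub>C x"
    and scaleC_one [simp]: "1 *\<^sub>C x = x"

text \<open>
  The inner product is linear in its first argument. Its real part is the inner product of the
  underlying real Hilbert space, so \<open>norm x = sqrt (Re (cinner x x))\<close> and positive definiteness
  are inherited from \<^class>\<open>real_inner\<close>; see \<open>cinner_self\<close> below. The zero space is not excluded.
\<close>

class chilbert_space = complex_vector + real_inner + banach +
  fixes cinner :: "'a \<Rightarrow> 'a \<Rightarrow> complex"
  assumes cinner_commute: "cinner x y = cnj (cinner y x)"
    and cinner_add_left: "cinner (x + y) z = cinner x z + cinner y z"
    and cinner_scaleC_left: "cinner (a *\<^sub>C x) y = a * cinner x y"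
    and inner_eq_Re_cinner: "inner x y = Re (cinner x y)"

lemma cinner_scaleC_right: "cinner x (a *\<^sub>C y) = cnj a * cinner x (y :: 'a::chilbert_space)"
  by (metis cinner_commute cinner_scaleC_left complex_cnj_mult)

lemma cinner_self: "cinner x x = complex_of_real ((norm (x :: 'a::chilbert_space))\<^sup>2)"
proof (rule complex_eqI)
  show "Re (cinner x x) = Re (complex_of_real ((norm x)\<^sup>2))"
    by (simp add: power2_norm_eq_inner inner_eq_Re_cinner)
  have "Im (cinner x x) = - Im (cinner x x)"
    by (metis cinner_commute cnj.simps(2))
  then show "Im (cinner x x) = Im (complex_of_real ((norm x)\<^sup>2))"
    by simp
qed

lemma norm_scaleC: "norm (a *\<^sub>C x) = cmod a * norm (x :: 'a::chilbert_space)"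
proof -
  have "complex_of_real ((norm (a *\<^sub>C x))\<^sup>2) = (a * cnj a) * complex_of_real ((norm x)\<^sup>2)"
    by (metis cinner_self cinner_scaleC_left cinner_scaleC_right mult.assoc)
  also have "\<dots> = complex_of_real ((cmod a * norm x)\<^sup>2)"
    by (simp add: complex_norm_square [symmetric] power_mult_distrib)
  finally have "(norm (a *\<^sub>C x))\<^sup>2 = (cmod a * norm x)\<^sup>2"
    using of_real_eq_iff by blast
  then show ?thesis
    by simp
qed

instantiation complex :: chilbert_space
begin

definition scaleC_complex :: "complex \<Rightarrow> complex \<Rightarrow> complex"
  where "scaleC_complex a x = a * x"

definition cinner_complex :: "complex \<Rightarrow> complex \<Rightarrow> complex"
  where "cinner_complex x y = x * cnj y"

instance
  by standard
    (auto simp: scaleC_complex_def cinner_complex_def scaleR_conv_of_real algebra_simps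
      inner_complex_def)

end


section \<open>The algebra of bounded linear operators\<close>

text \<open>
  \<^typ>\<open>'a \<Rightarrow>\<^sub>L 'a\<close> consists of the real-linear bounded maps; the algebra of bounded operators is
  its closed subalgebra of complex-linear maps, with the operator norm. The unit is not required to
  differ from \<open>0\<close>, because the zero space is allowed.
\<close>

typedef (overloaded) 'a bop =
  "{T :: 'a::chilbert_space \<Rightarrow>\<^sub>L 'a. \<forall>c x. blinfun_apply T (c *\<^sub>C x) = c *\<^sub>C blinfun_apply T x}"
  morphisms blinfun_of_bop Abs_bop
proof
  show "id_blinfun \<in> {T :: 'a \<Rightarrow>\<^sub>L 'a.
      \<forall>c x. blinfun_apply T (c *\<^sub>C x) = c *\<^sub>C blinfun_apply T x}"
    by simp
qed

setup_lifting type_definition_bop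

lift_definition bop_apply :: "'a::chilbert_space bop \<Rightarrow> 'a \<Rightarrow> 'a" is blinfun_apply .

lemma scaleC_zero_right [simp]: "a *\<^sub>C 0 = (0 :: 'a::complex_vector)"
  using scaleC_add_right [of a 0 0] by simp

lemma scaleC_minus_right [simp]: "a *\<^sub>C (- x) = - (a *\<^sub>C (x :: 'a::complex_vector))"
  by (metis add.right_inverse eq_neg_iff_add_eq_0 add.commute scaleC_add_right scaleC_zero_right)

lemma scaleC_diff_right: "a *\<^sub>C (x - y) = a *\<^sub>C x - a *\<^sub>C (y :: 'a::complex_vector)"
  by (metis diff_conv_add_uminus scaleC_add_right scaleC_minus_right)

lemma bounded_linear_scaleC: "bounded_linear (\<lambda>x :: 'a::chilbert_space. a *\<^sub>C x)"
  by (rule bounded_linear_intro [where K = "cmod a"])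
    (simp_all add: scaleC_add_right scaleR_scaleC norm_scaleC mult.commute)

instantiation bop :: (chilbert_space) "{complex_vector, real_normed_algebra, monoid_mult}"
begin

lift_definition zero_bop :: "'a bop" is 0 by simp
lift_definition one_bop :: "'a bop" is id_blinfun by simp
lift_definition plus_bop :: "'a bop \<Rightarrow> 'a bop \<Rightarrow> 'a bop" is "(+)"
  by (simp add: blinfun.add_left scaleC_add_right)
lift_definition minus_bop :: "'a bop \<Rightarrow> 'a bop \<Rightarrow> 'a bop" is "(-)"
  by (simp add: blinfun.diff_left scaleC_diff_right)
lift_definition uminus_bop :: "'a bop \<Rightarrow> 'a bop" is uminus
  by (simp add: blinfun.minus_left)
lift_definition times_bop :: "'a bop \<Rightarrow> 'a bop \<Rightarrow> 'a bop" is "(o\<^sub>L)"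
  by simp
lift_definition scaleR_bop :: "real \<Rightarrow> 'a bop \<Rightarrow> 'a bop" is "(*\<^sub>R)"
  by (simp add: blinfun.scaleR_left scaleR_scaleC mult.commute)
lift_definition scaleC_bop :: "complex \<Rightarrow> 'a bop \<Rightarrow> 'a bop"
  is "\<lambda>c T. Blinfun (\<lambda>x. c *\<^sub>C x) o\<^sub>L T"
  by (simp add: bounded_linear_scaleC bounded_linear_Blinfun_apply mult.commute)
lift_definition norm_bop :: "'a bop \<Rightarrow> real" is norm .

definition dist_bop :: "'a bop \<Rightarrow> 'a bop \<Rightarrow> real"
  where "dist_bop S T = norm (S - T)"
definition sgn_bop :: "'a bop \<Rightarrow> 'a bop"
  where "sgn_bop T = scaleR (inverse (norm T)) T"
definition uniformity_bop :: "('a bop \<times> 'a bop) filter"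
  where "uniformity_bop = (INF e\<in>{0 <..}. principal {(S, T). dist S T < e})"
definition open_bop :: "'a bop set \<Rightarrow> bool"
  where "open_bop U \<longleftrightarrow> (\<forall>S\<in>U. \<forall>\<^sub>F (S', T) in uniformity. S' = S \<longrightarrow> T \<in> U)"

instance
proof
  fix S T U :: "'a bop" and a b :: complex and r s :: real
  show "S + T + U = S + (T + U)" by transfer simp
  show "S + T = T + S" by transfer simp
  show "0 + S = S" by transfer simp
  show "- S + S = 0" by transfer simp
  show "S - T = S + - T" by transfer simp
  show "S * T * U = S * (T * U)" by transfer (simp add: blinfun_eqI)
  show "(S + T) * U = S * U + T * U"
    by transfer (simp add: blinfun_eqI blinfun.add_left)
  show "S * (T + U) = S * T + S * U"
    by transfer (simp add: blinfun_eqI blinfun.add_left blinfun.add_right)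
  show "1 * S = S" by transfer (simp add: blinfun_eqI)
  show "S * 1 = S" by transfer (simp add: blinfun_eqI)
  show "r *\<^sub>R (S + T) = r *\<^sub>R S + r *\<^sub>R T" by transfer (simp add: scaleR_add_right)
  show "(r + s) *\<^sub>R S = r *\<^sub>R S + s *\<^sub>R S" by transfer (simp add: scaleR_add_left)
  show "r *\<^sub>R s *\<^sub>R S = (r * s) *\<^sub>R S" by transfer simp
  show "1 *\<^sub>R S = S" by transfer simp
  show "r *\<^sub>R S * T = r *\<^sub>R (S * T)" by transfer (simp add: blinfun_eqI blinfun.scaleR_left)
  show "S * r *\<^sub>R T = r *\<^sub>R (S * T)"
    by transfer (simp add: blinfun_eqI blinfun.scaleR_left blinfun.scaleR_right)
  note scaleC = bounded_linear_scaleC bounded_linear_Blinfun_apply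
  show "r *\<^sub>R S = complex_of_real r *\<^sub>C S"
    by transfer (rule blinfun_eqI, simp add: scaleC blinfun.scaleR_left scaleR_scaleC)
  show "a *\<^sub>C (S + T) = a *\<^sub>C S + a *\<^sub>C T"
    by transfer (rule blinfun_eqI, simp add: scaleC blinfun.add_left scaleC_add_right)
  show "(a + b) *\<^sub>C S = a *\<^sub>C S + b *\<^sub>C S"
    by transfer (rule blinfun_eqI, simp add: scaleC blinfun.add_left scaleC_add_left)
  show "a *\<^sub>C b *\<^sub>C S = (a * b) *\<^sub>C S"
    by transfer (rule blinfun_eqI, simp add: scaleC)
  show "1 *\<^sub>C S = S"
    by transfer (rule blinfun_eqI, simp add: scaleC)
  show "norm S = 0 \<longleftrightarrow> S = 0" by transfer simp
  show "norm (S + T) \<le> norm S + norm T" by transfer (rule norm_triangle_ineq)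
  show "norm (r *\<^sub>R S) = \<bar>r\<bar> * norm S" by transfer simp
  show "norm (S * T) \<le> norm S * norm T" by transfer (rule norm_blinfun_compose)
qed (simp_all add: dist_bop_def sgn_bop_def uniformity_bop_def open_bop_def)

end

instance bop :: (chilbert_space) banach
proof
  fix X :: "nat \<Rightarrow> 'a bop"
  assume "Cauchy X"
  have dist_eq: "dist (blinfun_of_bop S) (blinfun_of_bop T) = dist S T" for S T :: "'a bop"
    by (simp add: dist_norm norm_bop.rep_eq minus_bop.rep_eq)
  from \<open>Cauchy X\<close> have "Cauchy (\<lambda>n. blinfun_of_bop (X n))"
    by (simp add: Cauchy_def dist_eq)
  then obtain L where L: "(\<lambda>n. blinfun_of_bop (X n)) \<longlonglongrightarrow> L"
    using Cauchy_convergent convergent_def by blast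
  have "blinfun_apply L (c *\<^sub>C x) = c *\<^sub>C blinfun_apply L x" for c x
  proof (rule LIMSEQ_unique)
    have apply_lim: "(\<lambda>n. blinfun_apply (blinfun_of_bop (X n)) y) \<longlonglongrightarrow> blinfun_apply L y" for y
      by (intro tendsto_intros L)
    show "(\<lambda>n. blinfun_apply (blinfun_of_bop (X n)) (c *\<^sub>C x)) \<longlonglongrightarrow> blinfun_apply L (c *\<^sub>C x)"
      by (rule apply_lim)
    have "(\<lambda>n. c *\<^sub>C blinfun_apply (blinfun_of_bop (X n)) x) \<longlonglongrightarrow> c *\<^sub>C blinfun_apply L x"
      by (rule bounded_linear.tendsto [OF bounded_linear_scaleC apply_lim])
    moreover have "blinfun_apply (blinfun_of_bop (X n)) (c *\<^sub>C x)
        = c *\<^sub>C blinfun_apply (blinfun_of_bop (X n)) x" for n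
      using blinfun_of_bop [of "X n"] by blast
    ultimately show "(\<lambda>n. blinfun_apply (blinfun_of_bop (X n)) (c *\<^sub>C x)) \<longlonglongrightarrow> c *\<^sub>C blinfun_apply L x"
      by simp
  qed
  then have L_eq: "blinfun_of_bop (Abs_bop L) = L"
    by (simp add: Abs_bop_inverse)
  have "X \<longlonglongrightarrow> Abs_bop L"
    using L by (simp add: tendsto_iff L_eq flip: dist_eq)
  then show "convergent X"
    by (auto simp: convergent_def)
qed

definition adj :: "'a::chilbert_space bop \<Rightarrow> 'a bop"
  where "adj T = (THE S. \<forall>x y. cinner (bop_apply T x) y = cinner x (bop_apply S y))"

text \<open>
  The element \<open>0\<close> is inserted only so that the numerical radius vanishes on the zero space, which has no unit vectors.
\<close>

definition numerical_radius :: "'a::chilbert_space bop \<Rightarrow> real"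
  where "numerical_radius T = Sup (insert 0 {cmod (cinner (bop_apply T x) x) | x. norm x = 1})"


section \<open>Spectrum, \<open>G\<^sub>1\<close> operators and the Riesz--Dunford calculus\<close>

definition is_inverse :: "'a::chilbert_space bop \<Rightarrow> 'a bop \<Rightarrow> bool"
  where "is_inverse T S \<longleftrightarrow> S * T = 1 \<and> T * S = 1"

definition spectrum :: "'a::chilbert_space bop \<Rightarrow> complex set"
  where "spectrum T = {z. \<nexists>S. is_inverse (z *\<^sub>C 1 - T) S}"

definition resolvent :: "'a::chilbert_space bop \<Rightarrow> complex \<Rightarrow> 'a bop"
  where "resolvent T z = (THE S. is_inverse (z *\<^sub>C 1 - T) S)"

definition G1_operator :: "'a::chilbert_space bop \<Rightarrow> bool"
  where "G1_operator T \<longleftrightarrow>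
    (\<forall>z. z \<notin> spectrum T \<longrightarrow> norm (resolvent T z) = 1 / infdist z (spectrum T))"

text \<open>
  The operator-valued counterpart of \<^const>\<open>contour_integral\<close>, which is restricted to
  complex-valued integrands.
\<close>

definition bop_contour_integral ::
    "(real \<Rightarrow> complex) \<Rightarrow> (complex \<Rightarrow> 'a::chilbert_space bop) \<Rightarrow> 'a bop"
  where "bop_contour_integral \<gamma> F =
    integral {0..1} (\<lambda>t. vector_derivative \<gamma> (at t within {0..1}) *\<^sub>C F (\<gamma> t))"

text \<open>
  A positively oriented simple closed contour that, together with its interior, lies in \<open>\<Omega>\<close>
  and has \<open>K\<close> in its interior.
\<close>

definition surrounds :: "(real \<Rightarrow> complex) \<Rightarrow> complex set \<Rightarrow> complex set \<Rightarrow> bool"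
  where "surrounds \<gamma> K \<Omega> \<longleftrightarrow>
    valid_path \<gamma> \<and> simple_path \<gamma> \<and> pathfinish \<gamma> = pathstart \<gamma> \<and>
    path_image \<gamma> \<subseteq> \<Omega> \<and> inside (path_image \<gamma>) \<subseteq> \<Omega> \<and> K \<subseteq> inside (path_image \<gamma>) \<and>
    (\<forall>z\<in>inside (path_image \<gamma>). winding_number \<gamma> z = 1)"

text \<open>
  For \<open>f\<close> analytic on the open set \<open>\<Omega>\<close>, the integral takes the same value along all contours
  surrounding the spectrum of \<open>T\<close> in \<open>\<Omega>\<close>, so the choice made by \<open>SOME\<close> is immaterial.
\<close>

definition riesz_dunford ::
    "complex set \<Rightarrow> (complex \<Rightarrow> complex) \<Rightarrow> 'a::chilbert_space bop \<Rightarrow> 'a bop"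
  where "riesz_dunford \<Omega> f T =
    (1 / (2 * of_real pi * \<i>)) *\<^sub>C
      bop_contour_integral (SOME \<gamma>. surrounds \<gamma> (spectrum T) \<Omega>) (\<lambda>z. f z *\<^sub>C resolvent T z)"


section \<open>The unit disc\<close>

abbreviation unit_disc :: "complex set"
  where "unit_disc \<equiv> ball 0 1"

definition dist_circle :: "'a::chilbert_space bop \<Rightarrow> real"
  where "dist_circle T = setdist (frontier unit_disc) (spectrum T)"

text \<open>The class of analytic functions on the disc with positive real part and value 1 at 0; a function on the disc is represented by any total extension of it.\<close>

definition class_A :: "(complex \<Rightarrow> complex) set"
  where "class_A = {f. f analytic_on unit_disc \<and> (\<forall>z\<in>unit_disc. Re (f z) > 0) \<and> f 0 = 1}"

abbreviation disc_calculus :: "(complex \<Rightarrow> complex) \<Rightarrow> 'a::chilbert_space bop \<Rightarrow> 'a bop"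
  where "disc_calculus \<equiv> riesz_dunford unit_disc"

definition conj_calculus :: "(complex \<Rightarrow> complex) \<Rightarrow> 'a::chilbert_space bop \<Rightarrow> 'a bop"
  where "conj_calculus f T = adj (disc_calculus f T)"

end

theory Submission
  imports Defs
begin

text \<open>
  Write \<open>R\<^sub>T(z) = (z - T)\<^sup>-\<^sup>1\<close> and call \<open>H\<^sub>T(w) = R\<^sub>T(w) (w + T)\<close> the Herglotz kernel of \<open>T\<close>. Functions with
  positive real part and \<open>f(0) = 1\<close> are averages of the scalar kernels \<open>(w + z) / (w - z)\<close>, and the
  operator version of this fact is that \<open>f(T)\<close> is an average of the operators \<open>H\<^sub>T(w)\<close>. On the circle
  \<open>|w| = r < 1\<close>, with \<open>r\<close> so large that the circle encloses \<open>\<sigma>(T)\<close>, the weight is explicit: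
  \<open>f(T)\<close> is the mean of \<open>Re f(w) H\<^sub>T(w)\<close> over the circle (\<open>disc_calculus_average\<close>). To see this, write
  \<open>2 Re f = f + cnj f\<close> and \<open>H\<^sub>T(w) = 2 w R\<^sub>T(w) - 1\<close>. The mean of \<open>f(w) w R\<^sub>T(w)\<close> is the integral defining
  \<open>f(T)\<close>, taken over the circle. On the circle \<open>cnj (f(w))\<close> coincides with \<open>cnj (f(r\<^sup>2 / cnj w))\<close>, which
  like \<open>w R\<^sub>T(w)\<close> is holomorphic outside the circle; hence the mean of their product is its value
  at infinity, \<open>cnj (f(0)) = 1\<close> (\<open>resolvent_reflected_mean\<close>). The calculus is defined through an arbitrary
  surrounding contour; its integral agrees with the one over the circle by the homology form of
  Cauchy's theorem (\<open>contour_integral_surrounding_eq_circle\<close>).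

  The two assertions concern the forms \<open>\<langle>S X T\<^sup>* v, v\<rangle> \<plusminus> \<langle>T X S\<^sup>* v, v\<rangle> + (1 \<plusminus> 1) \<langle>X v, v\<rangle>\<close> at \<open>S = f(A)\<close>
  and \<open>T = f(B)\<close>. These are real-affine in \<open>S\<close> and in \<open>T\<close>, so a bound for all kernels
  \<open>S = H\<^sub>A(z\<^sub>1)\<close>, \<open>T = H\<^sub>B(z\<^sub>2)\<close> survives averaging (\<open>sesquilinear_average_bound\<close>). For the kernels, put
  \<open>p = R\<^sub>A(z\<^sub>1)\<^sup>* v\<close>, \<open>q = R\<^sub>B(z\<^sub>2)\<^sup>* v\<close> and \<open>c = z\<^sub>1 cnj z\<^sub>2\<close>. The form becomes
  twice \<open>(c \<langle>X q, p\<rangle> \<plusminus> cnj c \<langle>X p, q\<rangle>) + (\<langle>A X B\<^sup>* q, p\<rangle> \<plusminus> \<langle>B X A\<^sup>* p, q\<rangle>)\<close>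
  (\<open>herglotz_kernel_form_bound\<close>). The phase of \<open>c\<close> is absorbed into \<open>q\<close>, which is why \<open>X\<close> contributes
  only \<open>2 w(X)\<close>; the rest is polarised into \<open>A X B\<^sup>* \<plusminus> B X A\<^sup>*\<close>. Everything carries the factor
  \<open>\<parallel>p\<parallel> \<parallel>q\<parallel> \<le> \<parallel>R\<^sub>A(z\<^sub>1)\<parallel> \<parallel>R\<^sub>B(z\<^sub>2)\<parallel>\<close>, which the \<open>G\<^sub>1\<close> condition bounds by
  \<open>1 / ((d\<^sub>A - (1 - r)) (d\<^sub>B - (1 - r)))\<close>, and \<open>r \<rightarrow> 1\<close> gives the theorem.
\<close>

section \<open>Complex inner products and bounded operators\<close>

lemma cinner_add_right: "cinner x (y + z) = cinner x y + cinner x (z :: 'a::chilbert_space)"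
  by (metis cinner_add_left cinner_commute complex_cnj_add)

lemma scaleC_minus_one: "(- 1) *\<^sub>C x = - (x :: 'a::chilbert_space)"
  using scaleR_scaleC [of "- 1" x] by simp

lemma cinner_minus_left: "cinner (- x) y = - cinner x (y :: 'a::chilbert_space)"
  using cinner_scaleC_left [of "- 1" x y] by (simp add: scaleC_minus_one)

lemma cinner_minus_right: "cinner x (- y) = - cinner x (y :: 'a::chilbert_space)"
  using cinner_scaleC_right [of x "- 1" y] by (simp add: scaleC_minus_one)

lemma cinner_diff_left: "cinner (x - y) z = cinner x z - cinner y (z :: 'a::chilbert_space)"
  using cinner_add_left [of x "- y" z] by (simp add: cinner_minus_left)

lemma cinner_diff_right: "cinner x (y - z) = cinner x y - cinner x (z :: 'a::chilbert_space)"
  using cinner_add_right [of x y "- z"] by (simp add: cinner_minus_right)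

lemma cinner_scaleR_left: "cinner (r *\<^sub>R x) y = of_real r * cinner x (y :: 'a::chilbert_space)"
  by (simp add: scaleR_scaleC cinner_scaleC_left)

lemma cinner_scaleR_right: "cinner x (r *\<^sub>R y) = of_real r * cinner x (y :: 'a::chilbert_space)"
  by (simp add: scaleR_scaleC cinner_scaleC_right)

lemma cinner_zero_left [simp]: "cinner 0 y = 0" and cinner_zero_right [simp]: "cinner y 0 = 0"
  for y :: "'a::chilbert_space"
  using cinner_diff_left [of y y y] cinner_diff_right [of y y y] by simp_all

lemmas cinner_linear = cinner_add_left cinner_add_right cinner_diff_left cinner_diff_right
  cinner_minus_left cinner_minus_right cinner_scaleC_left cinner_scaleC_right
  cinner_scaleR_left cinner_scaleR_right

lemma Im_cinner: "Im (cinner x y) = - inner (\<i> *\<^sub>C x) (y :: 'a::chilbert_space)"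
  by (simp add: inner_eq_Re_cinner cinner_scaleC_left)

text \<open>
  The imaginary part of an inner product is, up to sign, the real part with \<open>\<i> x\<close> in place of \<open>x\<close>,
  so an identity of real inner products upgrades once \<open>u\<close> commutes with \<open>\<i>\<close>.
\<close>

lemma cinner_eq_from_inner:
  fixes u :: "'a::chilbert_space \<Rightarrow> 'a"
  assumes "\<And>x. inner (u x) y = inner x z" and "\<And>x. u (\<i> *\<^sub>C x) = \<i> *\<^sub>C u x"
  shows "cinner (u x) y = cinner x z"
  using assms(1) [of x] assms(1) [of "\<i> *\<^sub>C x"] assms(2) [of x]
  by (intro complex_eqI) (simp_all add: Im_cinner flip: inner_eq_Re_cinner)

lemma cinner_eqI:
  fixes x y :: "'a::chilbert_space"
  assumes "\<And>z. cinner z x = cinner z y"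
  shows "x = y"
proof -
  have "inner (x - y) (x - y) = 0"
    using assms [of "x - y"] by (simp add: inner_eq_Re_cinner cinner_linear)
  then show ?thesis by simp
qed

lemma cinner_Cauchy_Schwarz: "cmod (cinner x y) \<le> norm x * norm (y :: 'a::chilbert_space)"
proof -
  obtain a where a: "cmod a = 1" "a * cinner x y = of_real (cmod (cinner x y))"
  proof (cases "cinner x y = 0")
    case True
    then show ?thesis using that [of 1] by simp
  next
    case False
    moreover have "cnj (cinner x y) * cinner x y = of_real (cmod (cinner x y)) * of_real (cmod (cinner x y))"
      by (metis complex_norm_square mult.commute of_real_power power2_eq_square)
    ultimately show ?thesis
      using that [of "cnj (cinner x y) / cmod (cinner x y)"] by (simp add: norm_divide)
  qed
  have "cmod (cinner x y) = inner (a *\<^sub>C x) y"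
    using a(2) by (simp add: inner_eq_Re_cinner cinner_scaleC_left)
  also have "\<dots> \<le> norm (a *\<^sub>C x) * norm y"
    by (rule norm_cauchy_schwarz)
  finally show ?thesis
    by (simp add: norm_scaleC a)
qed

lemma bop_apply_simps [simp]:
  fixes S T :: "'a::chilbert_space bop"
  shows "bop_apply (S * T) x = bop_apply S (bop_apply T x)"
    and "bop_apply (S + T) x = bop_apply S x + bop_apply T x"
    and "bop_apply (S - T) x = bop_apply S x - bop_apply T x"
    and "bop_apply (- T) x = - bop_apply T x"
    and "bop_apply (r *\<^sub>R T) x = r *\<^sub>R bop_apply T x"
    and "bop_apply (c *\<^sub>C T) x = c *\<^sub>C bop_apply T x"
    and "bop_apply 1 x = x"
    and "bop_apply 0 x = 0"
  by (transfer, simp add: blinfun.bilinear_simps bounded_linear_scaleC bounded_linear_Blinfun_apply)+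

lemma bop_apply_linear:
  fixes T :: "'a::chilbert_space bop"
  shows "bop_apply T (x + y) = bop_apply T x + bop_apply T y"
    and "bop_apply T (x - y) = bop_apply T x - bop_apply T y"
    and "bop_apply T (r *\<^sub>R x) = r *\<^sub>R bop_apply T x"
    and "bop_apply T (c *\<^sub>C x) = c *\<^sub>C bop_apply T x"
    and "bop_apply T 0 = 0"
  by (transfer, simp add: blinfun.bilinear_simps)+

lemma norm_bop_apply: "norm (bop_apply T x) \<le> norm T * norm (x :: 'a::chilbert_space)"
  by transfer (rule norm_blinfun)

lemma bop_eqI: "(\<And>x. bop_apply S x = bop_apply T x) \<Longrightarrow> S = (T :: 'a::chilbert_space bop)"
  by transfer (simp add: blinfun_eqI)

lemma bop_of_bounded:
  fixes g :: "'a::chilbert_space \<Rightarrow> 'a"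
  assumes "\<And>x y. g (x + y) = g x + g y" and "\<And>c x. g (c *\<^sub>C x) = c *\<^sub>C g x"
    and "\<And>x. norm (g x) \<le> K * norm x"
  obtains T where "bop_apply T = g"
proof -
  have "bounded_linear g"
    using assms by (intro bounded_linear_intro [where K = K]) (simp_all add: scaleR_scaleC mult.commute)
  then have "bop_apply (Abs_bop (Blinfun g)) = g"
    using assms(2) by (simp add: bop_apply.rep_eq Abs_bop_inverse bounded_linear_Blinfun_apply)
  then show ?thesis by (rule that)
qed

lemma norm_scaleC_bop_le: "norm (c *\<^sub>C T) \<le> cmod c * norm (T :: 'a::chilbert_space bop)"
proof -
  have "norm (blinfun_apply (Blinfun (\<lambda>x. c *\<^sub>C x) o\<^sub>L U) y) \<le> cmod c * norm U * norm y"
    for U :: "'a \<Rightarrow>\<^sub>L 'a" and y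
    using mult_left_mono [OF norm_blinfun [of U y], of "cmod c"]
    by (simp add: bounded_linear_scaleC bounded_linear_Blinfun_apply norm_scaleC mult.assoc)
  then have "norm (Blinfun (\<lambda>x. c *\<^sub>C x) o\<^sub>L U) \<le> cmod c * norm U" for U :: "'a \<Rightarrow>\<^sub>L 'a"
    by (intro norm_blinfun_bound) simp_all
  then show ?thesis
    by (simp add: norm_bop.rep_eq scaleC_bop.rep_eq)
qed

lemma bounded_bilinear_scaleC:
  "bounded_bilinear (\<lambda>(c::complex) (T :: 'a::chilbert_space bop). c *\<^sub>C T)"
proof
  show "\<exists>K. \<forall>(c::complex) (T :: 'a bop). norm (c *\<^sub>C T) \<le> norm c * norm T * K"
    by (intro exI [of _ 1]) (simp add: norm_scaleC_bop_le)
  show "(r *\<^sub>R c) *\<^sub>C T = r *\<^sub>R c *\<^sub>C T" for r and c :: complex and T :: "'a bop"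
    by (simp add: scaleR_conv_of_real scaleR_scaleC [of r "c *\<^sub>C T"])
  show "c *\<^sub>C r *\<^sub>R T = r *\<^sub>R c *\<^sub>C T" for r and c :: complex and T :: "'a bop"
    by (simp only: scaleR_scaleC scaleC_scaleC mult.commute)
qed (simp_all add: scaleC_add_left scaleC_add_right)

lemma bounded_linear_matrix_element:
  "bounded_linear (\<lambda>T. cinner (bop_apply T x) (y :: 'a::chilbert_space))"
proof (rule bounded_linear_intro [where K = "norm x * norm y"])
  fix T :: "'a bop"
  have "cmod (cinner (bop_apply T x) y) \<le> norm (bop_apply T x) * norm y"
    by (rule cinner_Cauchy_Schwarz)
  also have "\<dots> \<le> (norm T * norm x) * norm y"
    by (intro mult_right_mono norm_bop_apply) simp
  finally show "norm (cinner (bop_apply T x) y) \<le> norm T * (norm x * norm y)"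
    by (simp add: mult.assoc)
qed (simp_all add: cinner_linear scaleR_conv_of_real)

lemma bop_eq_matrix_elementsI:
  fixes S T :: "'a::chilbert_space bop"
  assumes "\<And>x y. cinner (bop_apply S x) y = cinner (bop_apply T x) y"
  shows "S = T"
proof (rule bop_eqI, rule cinner_eqI)
  fix x z
  show "cinner z (bop_apply S x) = cinner z (bop_apply T x)"
    using assms [of x z] by (simp add: cinner_commute [of z])
qed

text \<open>
  The representing vector minimises \<open>J(x) = \<parallel>x\<parallel>\<^sup>2 - 2 g(x)\<close>. The parallelogram law makes every minimising
  sequence Cauchy, and the first variation of \<open>J\<close> at the minimum is \<open>2 (\<langle>x, z\<rangle> - g x)\<close>.
\<close>

lemma Riesz_representation:
  fixes g :: "'a::{real_inner, banach} \<Rightarrow> real"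
  assumes g: "bounded_linear g"
  obtains z where "\<And>x. g x = inner x z"
proof -
  interpret g: bounded_linear g by fact
  define J where "J = (\<lambda>x. (norm x)\<^sup>2 - 2 * g x)"
  obtain K where K: "K \<ge> 0" "\<And>x. norm (g x) \<le> norm x * K"
    using g.nonneg_bounded by blast
  have "J x \<ge> - (K\<^sup>2)" for x
  proof -
    have "g x \<le> norm x * K" using K(2) [of x] by simp
    moreover have "0 \<le> (norm x - K)\<^sup>2" by simp
    ultimately show ?thesis by (simp add: J_def power2_eq_square algebra_simps)
  qed
  then have bdd: "bdd_below (range J)" by (auto simp: bdd_below_def)
  define m where "m = Inf (range J)"
  have m_le: "m \<le> J x" for x
    unfolding m_def by (rule cInf_lower [OF _ bdd]) simp
  have "\<exists>x. J x < m + inverse (real (Suc n))" for n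
  proof -
    have "Inf (range J) < m + inverse (real (Suc n))" by (simp add: m_def)
    then show ?thesis using cInf_less_iff [OF _ bdd] by blast
  qed
  then obtain u where u: "\<And>n. J (u n) < m + inverse (real (Suc n))" by metis
  have par: "(norm (x - y))\<^sup>2 = 2 * J x + 2 * J y - 4 * J ((1/2) *\<^sub>R (x + y))" for x y
    by (simp add: J_def g.add g.scaleR power2_norm_eq_inner inner_add inner_diff inner_commute
        algebra_simps)
  have close: "(norm (u i - u j))\<^sup>2 < 4 * inverse (real (Suc N))" if "N \<le> i" "N \<le> j" for i j N
  proof -
    have "inverse (real (Suc i)) \<le> inverse (real (Suc N))"
      "inverse (real (Suc j)) \<le> inverse (real (Suc N))"
      using that by (auto intro!: le_imp_inverse_le)
    then show ?thesis
      using u [of i] u [of j] m_le [of "(1/2) *\<^sub>R (u i + u j)"] par [of "u i" "u j"] by linarith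
  qed
  have "Cauchy u"
  proof (rule metric_CauchyI)
    fix e :: real assume "e > 0"
    then obtain N where "inverse (real (Suc N)) < e\<^sup>2 / 4"
      using reals_Archimedean [of "e\<^sup>2 / 4"] by auto
    then have "(norm (u i - u j))\<^sup>2 < e\<^sup>2" if "N \<le> i" "N \<le> j" for i j
      using close [OF that] by linarith
    then show "\<exists>M. \<forall>i\<ge>M. \<forall>j\<ge>M. dist (u i) (u j) < e"
      using \<open>e > 0\<close> by (metis dist_norm less_imp_le power_less_imp_less_base)
  qed
  then obtain z where z: "u \<longlonglongrightarrow> z" using Cauchy_convergent convergent_def by blast
  have "(\<lambda>n. J (u n)) \<longlonglongrightarrow> J z"
    unfolding J_def by (intro tendsto_intros z g.tendsto)
  moreover have "(\<lambda>n. J (u n)) \<longlonglongrightarrow> m"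
  proof (rule tendsto_sandwich [of "\<lambda>_. m" _ _ "\<lambda>n. m + inverse (real (Suc n))"])
    show "(\<lambda>n. m + inverse (real (Suc n))) \<longlonglongrightarrow> m"
      by (rule LIMSEQ_inverse_real_of_nat_add)
    show "\<forall>\<^sub>F n in sequentially. J (u n) \<le> m + inverse (real (Suc n))"
      using u by (intro always_eventually allI less_imp_le)
  qed (use m_le in auto)
  ultimately have Jz: "J z = m" by (rule LIMSEQ_unique)
  have "g x = inner x z" for x
  proof -
    define d where "d = inner x z - g x"
    have *: "0 \<le> 2 * t * d + t\<^sup>2 * (norm x)\<^sup>2" for t
    proof -
      have "(norm (z + t *\<^sub>R x))\<^sup>2 = (norm z)\<^sup>2 + 2 * t * inner x z + t\<^sup>2 * (norm x)\<^sup>2"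
        unfolding power2_norm_eq_inner
        by (simp add: inner_add inner_commute [of z x] power2_eq_square algebra_simps)
      then show ?thesis
        using m_le [of "z + t *\<^sub>R x"] Jz by (simp add: J_def d_def g.add g.scaleR algebra_simps)
    qed
    have "d = 0"
    proof (cases "x = 0")
      case True
      then show ?thesis by (simp add: d_def g.zero)
    next
      case False
      \<comment> \<open>The value of \<open>t\<close> minimising the quadratic, which makes it negative unless \<open>d = 0\<close>.\<close>
      then have "2 * (- d / (norm x)\<^sup>2) * d + (- d / (norm x)\<^sup>2)\<^sup>2 * (norm x)\<^sup>2 = - (d\<^sup>2 / (norm x)\<^sup>2)"
        by (simp add: field_simps power2_eq_square)
      with * [of "- d / (norm x)\<^sup>2"] have "d\<^sup>2 / (norm x)\<^sup>2 \<le> 0" by linarith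
      then show ?thesis using False by (simp add: divide_le_0_iff)
    qed
    then show ?thesis by (simp add: d_def)
  qed
  then show ?thesis by (rule that)
qed

text \<open>
  Stated for a mere function \<open>g\<close>: it supplies the boundedness from which the adjoint is constructed,
  and afterwards bounds the adjoint itself.
\<close>

lemma norm_formal_adjoint_le:
  fixes T :: "'a::chilbert_space bop"
  assumes "\<And>x y. cinner (bop_apply T x) y = cinner x (g y)"
  shows "norm (g y) \<le> norm T * norm y"
proof -
  have "(norm (g y))\<^sup>2 = cmod (cinner (bop_apply T (g y)) y)"
    by (simp add: assms cinner_self norm_power)
  also have "\<dots> \<le> norm (bop_apply T (g y)) * norm y" by (rule cinner_Cauchy_Schwarz)
  also have "\<dots> \<le> (norm T * norm (g y)) * norm y"
    by (intro mult_right_mono norm_bop_apply) simp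
  finally have "norm (g y) * norm (g y) \<le> norm (g y) * (norm T * norm y)"
    by (simp add: power2_eq_square mult_ac)
  then show ?thesis
    by (cases "norm (g y) = 0") (simp_all add: mult_le_cancel_left)
qed

lemma adj_exists:
  fixes T :: "'a::chilbert_space bop"
  obtains S where "\<And>x y. cinner (bop_apply T x) y = cinner x (bop_apply S y)"
proof -
  have "\<exists>z. \<forall>x. cinner (bop_apply T x) y = cinner x z" for y
  proof -
    have "bounded_linear (\<lambda>x. inner (bop_apply T x) y)"
    proof (rule bounded_linear_intro [where K = "norm T * norm y"])
      fix x
      have "norm (inner (bop_apply T x) y) \<le> norm (bop_apply T x) * norm y"
        using Cauchy_Schwarz_ineq2 by simp
      also have "\<dots> \<le> (norm T * norm x) * norm y"
        by (intro mult_right_mono norm_bop_apply) simp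
      finally show "norm (inner (bop_apply T x) y) \<le> norm x * (norm T * norm y)"
        by (simp add: mult_ac)
    qed (simp_all add: bop_apply_linear inner_add_left)
    then obtain z where "\<And>x. inner (bop_apply T x) y = inner x z"
      using Riesz_representation by blast
    then have "cinner (bop_apply T x) y = cinner x z" for x
      by (rule cinner_eq_from_inner) (simp add: bop_apply_linear)
    then show ?thesis by blast
  qed
  then obtain g where g: "\<And>x y. cinner (bop_apply T x) y = cinner x (g y)" by metis
  have "norm (g y) \<le> norm T * norm y" for y
    by (rule norm_formal_adjoint_le [OF g])
  moreover have "g (y + z) = g y + g z" for y z
    by (rule cinner_eqI) (metis g cinner_add_right)
  moreover have "g (c *\<^sub>C y) = c *\<^sub>C g y" for c y
    by (rule cinner_eqI) (metis g cinner_scaleC_right)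
  ultimately obtain S where "bop_apply S = g" using bop_of_bounded by metis
  then show ?thesis using that g by metis
qed

lemma cinner_adj: "cinner (bop_apply T x) y = cinner x (bop_apply (adj T) (y :: 'a::chilbert_space))"
proof -
  obtain S where S: "\<And>x y. cinner (bop_apply T x) y = cinner x (bop_apply S y)"
    using adj_exists [of T] by metis
  have "adj T = S"
    unfolding adj_def
  proof (rule the_equality)
    fix S' assume "\<forall>x y. cinner (bop_apply T x) y = cinner x (bop_apply S' y)"
    then show "S' = S" using S by (metis bop_eqI cinner_eqI)
  qed (use S in blast)
  then show ?thesis using S by simp
qed

lemma cinner_adj_left: "cinner (bop_apply (adj T) x) y = cinner x (bop_apply T (y :: 'a::chilbert_space))"
  by (metis cinner_adj cinner_commute)

lemma norm_adj_apply: "norm (bop_apply (adj T) y) \<le> norm T * norm (y :: 'a::chilbert_space)"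
  by (rule norm_formal_adjoint_le [OF cinner_adj])

lemma adj_mult_apply:
  "bop_apply (adj (S * T)) x = bop_apply (adj T) (bop_apply (adj S) (x :: 'a::chilbert_space))"
  by (rule cinner_eqI) (simp flip: cinner_adj)

lemma adj_scaleC_one_plus: "bop_apply (adj (c *\<^sub>C 1 + T)) x = cnj c *\<^sub>C x + bop_apply (adj T) (x :: 'a::chilbert_space)"
  by (rule cinner_eqI) (simp add: cinner_linear flip: cinner_adj)

lemma adj_scaleC_one_minus: "bop_apply (adj (c *\<^sub>C 1 - T)) x = cnj c *\<^sub>C x - bop_apply (adj T) (x :: 'a::chilbert_space)"
  by (rule cinner_eqI) (simp add: cinner_linear flip: cinner_adj)

section \<open>Numerical radius\<close>

lemma numerical_radius_bdd:
  "bdd_above (insert 0 {cmod (cinner (bop_apply T x) x) | x. norm (x :: 'a::chilbert_space) = 1})"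
proof -
  have "cmod (cinner (bop_apply T x) x) \<le> norm T" if "norm x = 1" for x
    using cinner_Cauchy_Schwarz [of "bop_apply T x" x] norm_bop_apply [of T x] that by simp
  then show ?thesis by (auto simp: bdd_above_def intro!: exI [of _ "norm T"])
qed

lemma numerical_radius_nonneg: "0 \<le> numerical_radius T"
  unfolding numerical_radius_def by (rule cSup_upper [OF _ numerical_radius_bdd]) simp

lemma numerical_radius_leI:
  fixes T :: "'a::chilbert_space bop"
  assumes "0 \<le> C" and "\<And>x. norm x = 1 \<Longrightarrow> cmod (cinner (bop_apply T x) x) \<le> C"
  shows "numerical_radius T \<le> C"
  unfolding numerical_radius_def by (rule cSup_least) (use assms in auto)

lemma numerical_radius_bound:
  fixes x :: "'a::chilbert_space"
  shows "cmod (cinner (bop_apply T x) x) \<le> numerical_radius T * (norm x)\<^sup>2"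
proof (cases "x = 0")
  case False
  define u where "u = (1 / norm x) *\<^sub>R x"
  have u: "norm u = 1" and x: "x = norm x *\<^sub>R u" using False by (simp_all add: u_def)
  have "cmod (cinner (bop_apply T u) u) \<le> numerical_radius T"
    unfolding numerical_radius_def by (rule cSup_upper [OF _ numerical_radius_bdd]) (use u in auto)
  moreover have "cinner (bop_apply T x) x = of_real ((norm x)\<^sup>2) * cinner (bop_apply T u) u"
    by (subst (1 2) x) (simp add: bop_apply_linear cinner_linear power2_eq_square)
  moreover from this have "cmod (cinner (bop_apply T x) x) = cmod (cinner (bop_apply T u) u) * (norm x)\<^sup>2"
    by (simp add: norm_mult norm_power)
  ultimately show ?thesis
    by (simp only: mult_right_mono zero_le_power2)
qed simp

text \<open>
  Polarisation and the parallelogram law give \<open>w(X) (\<parallel>p\<parallel>\<^sup>2 + \<parallel>q\<parallel>\<^sup>2)\<close> as a bound. The left-hand side does not change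
  under \<open>p \<mapsto> t p\<close>, \<open>q \<mapsto> q / t\<close>, and the best \<open>t\<close> turns the sum of squares into \<open>2 \<parallel>p\<parallel> \<parallel>q\<parallel>\<close>.
\<close>

lemma cinner_symmetrized_bound:
  fixes p q :: "'a::chilbert_space"
  shows "cmod (cinner (bop_apply X q) p + cinner (bop_apply X p) q) \<le> 2 * numerical_radius X * (norm p * norm q)"
proof (cases "p = 0 \<or> q = 0")
  case True
  then show ?thesis by (auto simp: bop_apply_linear)
next
  case False
  let ?w = "numerical_radius X"
  have *: "cmod (cinner (bop_apply X q) p + cinner (bop_apply X p) q) \<le> ?w * ((norm p)\<^sup>2 + (norm q)\<^sup>2)"
    for p q :: 'a
  proof -
    have "2 * (cinner (bop_apply X q) p + cinner (bop_apply X p) q)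
        = cinner (bop_apply X (p + q)) (p + q) - cinner (bop_apply X (p - q)) (p - q)"
      by (simp add: bop_apply_linear cinner_linear)
    then have "2 * cmod (cinner (bop_apply X q) p + cinner (bop_apply X p) q)
        = cmod (cinner (bop_apply X (p + q)) (p + q) - cinner (bop_apply X (p - q)) (p - q))"
      by (metis norm_mult norm_numeral)
    also have "\<dots> \<le> ?w * (norm (p + q))\<^sup>2 + ?w * (norm (p - q))\<^sup>2"
      by (intro norm_triangle_le_diff add_mono numerical_radius_bound)
    also have "\<dots> = 2 * (?w * ((norm p)\<^sup>2 + (norm q)\<^sup>2))"
      by (simp add: power2_norm_eq_inner inner_add inner_diff inner_commute algebra_simps)
    finally show ?thesis by simp
  qed
  define t where "t = sqrt (norm q / norm p)"
  have t: "t > 0" "t\<^sup>2 = norm q / norm p" using False by (simp_all add: t_def)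
  have "cinner (bop_apply X q) p + cinner (bop_apply X p) q
      = cinner (bop_apply X ((1 / t) *\<^sub>R q)) (t *\<^sub>R p) + cinner (bop_apply X (t *\<^sub>R p)) ((1 / t) *\<^sub>R q)"
    using t(1) by (simp add: bop_apply_linear cinner_linear)
  then have "cmod (cinner (bop_apply X q) p + cinner (bop_apply X p) q)
      \<le> ?w * ((norm (t *\<^sub>R p))\<^sup>2 + (norm ((1 / t) *\<^sub>R q))\<^sup>2)"
    using * by metis
  also have "(norm (t *\<^sub>R p))\<^sup>2 + (norm ((1 / t) *\<^sub>R q))\<^sup>2 = 2 * (norm p * norm q)"
    using False by (simp add: power_mult_distrib power_divide t(2)) (simp add: field_simps power2_eq_square)
  finally show ?thesis by (simp add: mult_ac)
qed

text \<open>
  Replacing \<open>q\<close> by \<open>c q\<close> absorbs the phase, so that only \<open>|c|\<close> enters; estimating the real and imaginary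
  parts of \<open>c\<close> separately would lose a factor of up to \<open>sqrt 2\<close>.
\<close>

lemma cinner_phased_symmetrized_bound:
  fixes p q :: "'a::chilbert_space"
  shows "cmod (c * cinner (bop_apply X q) p + cnj c * cinner (bop_apply X p) q)
      \<le> 2 * cmod c * numerical_radius X * (norm p * norm q)"
  using cinner_symmetrized_bound [of X "c *\<^sub>C q" p]
  by (simp add: bop_apply_linear cinner_linear norm_scaleC mult_ac)

lemma cinner_phased_antisymmetrized_bound:
  fixes p q :: "'a::chilbert_space"
  shows "cmod (c * cinner (bop_apply X q) p - cnj c * cinner (bop_apply X p) q)
      \<le> 2 * cmod c * numerical_radius X * (norm p * norm q)"
proof -
  \<comment> \<open>A relative minus sign is the phase \<open>\<i>\<close>, because \<open>cnj (\<i> c) = - \<i> cnj c\<close>.\<close>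
  have "cmod (c * cinner (bop_apply X q) p - cnj c * cinner (bop_apply X p) q)
     = cmod (\<i> * (c * cinner (bop_apply X q) p - cnj c * cinner (bop_apply X p) q))"
    by (simp add: norm_mult)
  also have "\<dots> = cmod ((\<i> * c) * cinner (bop_apply X q) p + cnj (\<i> * c) * cinner (bop_apply X p) q)"
    by (simp add: algebra_simps)
  also have "\<dots> \<le> 2 * cmod (\<i> * c) * numerical_radius X * (norm p * norm q)"
    by (rule cinner_phased_symmetrized_bound)
  finally show ?thesis by (simp add: norm_mult)
qed

text \<open>
  With \<open>P = M + N\<close> and \<open>Q = M - N\<close>, the \<open>M\<close>-part is symmetric in \<open>p\<close> and \<open>q\<close> up to the sign \<open>s\<close>, the
  \<open>N\<close>-part up to \<open>- s\<close>, and each is covered by one of the two phased bounds.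
\<close>

lemma cinner_cross_bound:
  fixes p q :: "'a::chilbert_space"
  assumes "s = 1 \<or> s = (- 1 :: complex)"
  shows "cmod (cinner (bop_apply P q) p + s * cinner (bop_apply Q p) q)
      \<le> (numerical_radius (P + Q) + numerical_radius (P - Q)) * (norm p * norm q)"
proof -
  define a where "a = cinner (bop_apply (P + Q) q) p + s * cinner (bop_apply (P + Q) p) q"
  define b where "b = cinner (bop_apply (P - Q) q) p - s * cinner (bop_apply (P - Q) p) q"
  have "2 * (cinner (bop_apply P q) p + s * cinner (bop_apply Q p) q) = a + b"
    by (simp add: a_def b_def cinner_linear algebra_simps)
  then have "2 * cmod (cinner (bop_apply P q) p + s * cinner (bop_apply Q p) q) = cmod (a + b)"
    by (metis norm_mult norm_numeral)
  also have "\<dots> \<le> cmod a + cmod b" by (rule norm_triangle_ineq)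
  also have "cmod a \<le> 2 * numerical_radius (P + Q) * (norm p * norm q)"
    using assms cinner_phased_symmetrized_bound [of 1 "P + Q" q p]
      cinner_phased_antisymmetrized_bound [of 1 "P + Q" q p] by (auto simp: a_def)
  also have "cmod b \<le> 2 * numerical_radius (P - Q) * (norm p * norm q)"
    using assms cinner_phased_symmetrized_bound [of 1 "P - Q" q p]
      cinner_phased_antisymmetrized_bound [of 1 "P - Q" q p] by (auto simp: b_def)
  finally show ?thesis by (simp add: algebra_simps)
qed


section \<open>Resolvents of \<open>G\<^sub>1\<close> operators\<close>

lemma resolvent_inverse:
  fixes T :: "'a::chilbert_space bop"
  assumes "z \<notin> spectrum T"
  shows "resolvent T z * (z *\<^sub>C 1 - T) = 1" and "(z *\<^sub>C 1 - T) * resolvent T z = 1"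
proof -
  obtain S where S: "is_inverse (z *\<^sub>C 1 - T) S"
    using assms by (auto simp: spectrum_def)
  have unique: "S' = S" if "is_inverse (z *\<^sub>C 1 - T) S'" for S'
  proof -
    have "S' = S' * ((z *\<^sub>C 1 - T) * S)" using S by (simp only: is_inverse_def mult_1_right)
    also have "\<dots> = S" using that by (simp only: is_inverse_def mult_1_left flip: mult.assoc)
    finally show ?thesis .
  qed
  have "is_inverse (z *\<^sub>C 1 - T) (resolvent T z)"
    unfolding resolvent_def by (rule theI [of _ S]) (use S unique in blast)+
  then show "resolvent T z * (z *\<^sub>C 1 - T) = 1" and "(z *\<^sub>C 1 - T) * resolvent T z = 1"
    by (simp_all add: is_inverse_def)
qed

lemma scaleC_mult_bop:
  fixes S T :: "'a::chilbert_space bop"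
  shows "(c *\<^sub>C S) * T = c *\<^sub>C (S * T)" and "S * (c *\<^sub>C T) = c *\<^sub>C (S * T)"
  by (rule bop_eqI, simp add: bop_apply_linear)+

lemma resolvent_identity:
  fixes T :: "'a::chilbert_space bop"
  assumes "z \<notin> spectrum T" "w \<notin> spectrum T"
  shows "resolvent T z - resolvent T w = (w - z) *\<^sub>C (resolvent T z * resolvent T w)"
proof -
  have "resolvent T z - resolvent T w
      = resolvent T z * ((w *\<^sub>C 1 - T) * resolvent T w) - (resolvent T z * (z *\<^sub>C 1 - T)) * resolvent T w"
    using assms by (simp add: resolvent_inverse)
  also have "\<dots> = resolvent T z * ((w *\<^sub>C 1 - T) - (z *\<^sub>C 1 - T)) * resolvent T w"
    by (simp only: mult.assoc right_diff_distrib left_diff_distrib)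
  also have "(w *\<^sub>C 1 - T) - (z *\<^sub>C 1 - T) = (w - z) *\<^sub>C 1"
    using scaleC_add_left [of "w - z" z "1 :: 'a bop"] by simp
  finally show ?thesis by (simp add: scaleC_mult_bop)
qed

lemma resolvent_times_scalar:
  fixes T :: "'a::chilbert_space bop"
  assumes "z \<notin> spectrum T"
  shows "z *\<^sub>C resolvent T z = 1 + T * resolvent T z"
  using resolvent_inverse(2) [OF assms] by (simp add: left_diff_distrib scaleC_mult_bop algebra_simps)

text \<open>
  On a nonzero space the \<open>G\<^sub>1\<close> condition alone forces the spectrum to be nonempty and closed:
  if the distance vanished off the spectrum (as it does for an empty spectrum, where \<^const>\<open>infdist\<close> is \<open>0\<close>),
  the equation \<open>\<parallel>R(z)\<parallel> = 1 / 0 = 0\<close> would contradict the invertibility of \<open>z - T\<close>.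
\<close>

lemma G1_infdist_pos:
  fixes T :: "'a::chilbert_space bop"
  assumes "G1_operator T" and "(1 :: 'a bop) \<noteq> 0" and "z \<notin> spectrum T"
  shows "infdist z (spectrum T) > 0"
proof (rule ccontr)
  assume "\<not> infdist z (spectrum T) > 0"
  then have "infdist z (spectrum T) = 0" using infdist_nonneg [of z "spectrum T"] by linarith
  then have "norm (resolvent T z) = 0" using assms by (simp add: G1_operator_def)
  then show False using resolvent_inverse(1) [OF assms(3)] assms(2) by simp
qed

lemma G1_spectrum_nonempty:
  fixes T :: "'a::chilbert_space bop"
  assumes "G1_operator T" and "(1 :: 'a bop) \<noteq> 0"
  shows "spectrum T \<noteq> {}"
  using G1_infdist_pos [OF assms, of 0] by (auto simp: infdist_def)

lemma G1_closed_spectrum: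
  fixes T :: "'a::chilbert_space bop"
  assumes "G1_operator T" and "(1 :: 'a bop) \<noteq> 0"
  shows "closed (spectrum T)"
proof -
  have "closure (spectrum T) \<subseteq> spectrum T"
    using G1_infdist_pos [OF assms] in_closure_iff_infdist_zero [OF G1_spectrum_nonempty [OF assms]]
    by force
  then show ?thesis by (simp add: closure_subset_eq)
qed

lemma G1_norm_resolvent_le:
  fixes T :: "'a::chilbert_space bop"
  assumes "G1_operator T" and "spectrum T \<noteq> {}" and "0 < d" and "\<And>s. s \<in> spectrum T \<Longrightarrow> d \<le> dist z s"
  shows "z \<notin> spectrum T" and "norm (resolvent T z) \<le> 1 / d"
proof -
  show z: "z \<notin> spectrum T" using assms(3) assms(4) [of z] by auto
  have "d \<le> infdist z (spectrum T)"
    unfolding infdist_notempty [OF assms(2)] by (rule cINF_greatest) (use assms in auto)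
  then show "norm (resolvent T z) \<le> 1 / d"
    using z assms(1,3) by (simp add: G1_operator_def frac_le)
qed

text \<open>
  By the resolvent identity \<open>\<parallel>R(w) - R(z)\<parallel> \<le> |z - w| \<parallel>R(w)\<parallel> \<parallel>R(z)\<parallel>\<close>, and the \<open>G\<^sub>1\<close> condition expresses both
  norms through the distance to the spectrum, which is continuous and positive.
\<close>

lemma continuous_on_resolvent:
  fixes T :: "'a::chilbert_space bop"
  assumes G1: "G1_operator T" and nontrivial: "(1 :: 'a bop) \<noteq> 0"
  shows "continuous_on (- spectrum T) (resolvent T)"
  unfolding continuous_on_def
proof
  fix z assume z: "z \<in> - spectrum T"
  let ?d = "\<lambda>w. infdist w (spectrum T)"
  have d: "?d z > 0" using G1_infdist_pos [OF assms] z by auto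
  have "((\<lambda>w. dist (resolvent T w) (resolvent T z)) \<longlongrightarrow> 0) (at z within - spectrum T)"
  proof (rule Lim_null_comparison)
    show "\<forall>\<^sub>F w in at z within - spectrum T.
        norm (dist (resolvent T w) (resolvent T z)) \<le> cmod (z - w) * ((1 / ?d w) * (1 / ?d z))"
      unfolding eventually_at_filter
    proof (intro always_eventually allI impI)
      fix w assume w: "w \<in> - spectrum T"
      have "norm (dist (resolvent T w) (resolvent T z))
          = norm ((z - w) *\<^sub>C (resolvent T w * resolvent T z))"
        using w z by (simp add: dist_norm resolvent_identity)
      also have "\<dots> \<le> cmod (z - w) * norm (resolvent T w * resolvent T z)"
        by (rule norm_scaleC_bop_le)
      also have "\<dots> \<le> cmod (z - w) * (norm (resolvent T w) * norm (resolvent T z))"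
        by (intro mult_left_mono norm_mult_ineq) simp
      finally show "norm (dist (resolvent T w) (resolvent T z)) \<le> cmod (z - w) * ((1 / ?d w) * (1 / ?d z))"
        using G1 w z by (simp add: G1_operator_def)
    qed
    have "((\<lambda>w. cmod (z - w) * ((1 / ?d w) * (1 / ?d z))) \<longlongrightarrow> cmod (z - z) * ((1 / ?d z) * (1 / ?d z)))
        (at z within - spectrum T)"
      using d by (intro tendsto_intros) simp_all
    then show "((\<lambda>w. cmod (z - w) * ((1 / ?d w) * (1 / ?d z))) \<longlongrightarrow> 0) (at z within - spectrum T)"
      by simp
  qed
  then show "(resolvent T \<longlongrightarrow> resolvent T z) (at z within - spectrum T)"
    by (subst tendsto_dist_iff)
qed

lemma holomorphic_resolvent_element:
  fixes T :: "'a::chilbert_space bop"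
  assumes "G1_operator T" and "(1 :: 'a bop) \<noteq> 0"
  shows "(\<lambda>z. cinner (bop_apply (resolvent T z) x) y) holomorphic_on (- spectrum T)"
proof -
  have "open (- spectrum T)" by (intro open_Compl G1_closed_spectrum assms)
  moreover have "((\<lambda>w. cinner (bop_apply (resolvent T w) x) y) has_field_derivative
      - cinner (bop_apply (resolvent T z * resolvent T z) x) y) (at z)" if z: "z \<in> - spectrum T" for z
    unfolding has_field_derivative_iff
  proof (rule Lim_transform_eventually)
    have "(resolvent T \<longlongrightarrow> resolvent T z) (at z)"
      using continuous_on_resolvent [OF assms] z \<open>open (- spectrum T)\<close>
      by (simp add: continuous_on_eq_continuous_at isCont_def)
    then have "((\<lambda>w. resolvent T w * resolvent T z) \<longlongrightarrow> resolvent T z * resolvent T z) (at z)"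
      by (intro tendsto_intros)
    then show "((\<lambda>w. - cinner (bop_apply (resolvent T w * resolvent T z) x) y)
        \<longlongrightarrow> - cinner (bop_apply (resolvent T z * resolvent T z) x) y) (at z)"
      by (intro tendsto_minus bounded_linear.tendsto [OF bounded_linear_matrix_element])
    have "\<forall>\<^sub>F w in at z. w \<in> - spectrum T \<and> w \<noteq> z"
      using \<open>open (- spectrum T)\<close> z
      by (intro eventually_conj eventually_at_in_open' eventually_neq_at_within)
    then show "\<forall>\<^sub>F w in at z. - cinner (bop_apply (resolvent T w * resolvent T z) x) y
      = (cinner (bop_apply (resolvent T w) x) y - cinner (bop_apply (resolvent T z) x) y) / (w - z)"
    proof eventually_elim
      case (elim w)
      have eq: "resolvent T w - resolvent T z = (z - w) *\<^sub>C (resolvent T w * resolvent T z)"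
        by (rule resolvent_identity) (use elim z in auto)
      have "cinner (bop_apply (resolvent T w) x) y - cinner (bop_apply (resolvent T z) x) y
          = cinner (bop_apply (resolvent T w - resolvent T z) x) y"
        by (simp add: cinner_diff_left)
      also have "\<dots> = (z - w) * cinner (bop_apply (resolvent T w * resolvent T z) x) y"
        by (subst eq) (simp only: bop_apply_simps cinner_scaleC_left)
      finally show ?case using elim by (simp add: field_simps)
    qed
  qed
  ultimately show ?thesis by (auto simp: holomorphic_on_open)
qed

text \<open>
  Because \<open>z R(z) = 1 + T R(z)\<close>, it suffices that \<open>R(z)\<close> vanishes at infinity; for \<open>|z| > 1\<close> the \<open>G\<^sub>1\<close>
  condition gives \<open>\<parallel>R(z)\<parallel> \<le> 1 / (|z| - 1)\<close>.
\<close>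

lemma resolvent_at_infinity:
  fixes T :: "'a::chilbert_space bop"
  assumes "G1_operator T" and "spectrum T \<noteq> {}" and "spectrum T \<subseteq> unit_disc"
  shows "((\<lambda>z. z * cinner (bop_apply (resolvent T z) x) y) \<longlongrightarrow> cinner x y) at_infinity"
proof -
  have far: "\<forall>\<^sub>F z in at_infinity. 2 \<le> cmod z"
    by (auto simp: eventually_at_infinity)
  have R: "z \<notin> spectrum T \<and> norm (resolvent T z) \<le> 1 / (cmod z - 1)" if "2 \<le> cmod z" for z
  proof -
    have "cmod z - 1 \<le> dist z s" if "s \<in> spectrum T" for s
      using that assms(3) norm_triangle_ineq2 [of z s] by (force simp: dist_norm)
    then show ?thesis
      using G1_norm_resolvent_le [OF assms(1,2), of "cmod z - 1" z] \<open>2 \<le> cmod z\<close> by auto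
  qed
  have "(resolvent T \<longlongrightarrow> 0) at_infinity"
  proof (rule Lim_null_comparison)
    show "\<forall>\<^sub>F z in at_infinity. norm (resolvent T z) \<le> 1 / (cmod z - 1)"
      using far by eventually_elim (use R in blast)
    have "((\<lambda>r. 1 / (r - 1)) \<longlongrightarrow> (0::real)) at_top" by real_asymp
    then show "((\<lambda>z. 1 / (cmod z - 1)) \<longlongrightarrow> 0) at_infinity"
      by (rule filterlim_compose) (rule filterlim_norm_at_top)
  qed
  then have "((\<lambda>z. 1 + T * resolvent T z) \<longlongrightarrow> 1 + T * 0) at_infinity"
    by (intro tendsto_intros)
  then have "((\<lambda>z. cinner (bop_apply (1 + T * resolvent T z) x) y) \<longlongrightarrow> cinner (bop_apply (1 + T * 0) x) y)
      at_infinity"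
    by (rule bounded_linear.tendsto [OF bounded_linear_matrix_element])
  then have lim: "((\<lambda>z. cinner (bop_apply (1 + T * resolvent T z) x) y) \<longlongrightarrow> cinner x y) at_infinity"
    by (simp only: mult_zero_right add_0_right bop_apply_simps)
  show ?thesis
  proof (rule Lim_transform_eventually [OF lim])
    show "\<forall>\<^sub>F z in at_infinity. cinner (bop_apply (1 + T * resolvent T z) x) y
        = z * cinner (bop_apply (resolvent T z) x) y"
      using far
    proof eventually_elim
      case (elim z)
      then have "1 + T * resolvent T z = z *\<^sub>C resolvent T z"
        using R resolvent_times_scalar by metis
      then show ?case by (simp only: bop_apply_simps cinner_scaleC_left)
    qed
  qed
qed


section \<open>Operator-valued contour integrals\<close>

text \<open>
  Norm continuity makes integrals over segments exist, and holomorphic matrix elements allow Cauchy's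
  theorem to be applied to them one scalar function at a time.
\<close>

definition weakly_holomorphic_on :: "(complex \<Rightarrow> 'a::chilbert_space bop) \<Rightarrow> complex set \<Rightarrow> bool"
  where "weakly_holomorphic_on H S \<longleftrightarrow>
    continuous_on S H \<and> (\<forall>x y. (\<lambda>z. cinner (bop_apply (H z) x) y) holomorphic_on S)"

lemma continuous_on_segment_integrand:
  fixes H :: "complex \<Rightarrow> 'a::chilbert_space bop"
  assumes "continuous_on S H" and "closed_segment a b \<subseteq> S"
  shows "continuous_on {0..1} (\<lambda>s. H (linepath a b s))"
proof (rule continuous_on_compose2 [OF assms(1)])
  show "linepath a b ` {0..1} \<subseteq> S" using assms(2) by (simp add: linepath_image_01)
qed (rule continuous_on_linepath)

lemma segment_integral_from_primitive:
  fixes H :: "complex \<Rightarrow> 'a::chilbert_space bop"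
  assumes cont: "continuous_on S H" and seg: "closed_segment a b \<subseteq> S"
    and g: "\<And>z. z \<in> S \<Longrightarrow> (g has_field_derivative cinner (bop_apply (H z) x) y) (at z within S)"
  shows "cinner (bop_apply (integral {0..1} (\<lambda>s. (b - a) *\<^sub>C H (linepath a b s))) x) y = g b - g a"
proof -
  have "(\<lambda>s. (b - a) *\<^sub>C H (linepath a b s)) integrable_on {0..1}"
    by (intro integrable_continuous_real bounded_bilinear.continuous_on [OF bounded_bilinear_scaleC]
        continuous_on_const continuous_on_segment_integrand [OF cont seg])
  from integral_linear [OF this bounded_linear_matrix_element, of x y]
  have "cinner (bop_apply (integral {0..1} (\<lambda>s. (b - a) *\<^sub>C H (linepath a b s))) x) y
      = integral {0..1} (\<lambda>s. cinner (bop_apply (H (linepath a b s)) x) y * (b - a))"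
    by (simp add: o_def cinner_scaleC_left mult.commute)
  also have "((\<lambda>z. cinner (bop_apply (H z) x) y) has_contour_integral (g b - g a)) (linepath a b)"
    using contour_integral_primitive [OF g, of "linepath a b"] seg by simp
  then have "integral {0..1} (\<lambda>s. cinner (bop_apply (H (linepath a b s)) x) y * (b - a)) = g b - g a"
    unfolding has_contour_integral_linepath by (rule integral_unique)
  finally show ?thesis .
qed

text \<open>
  The primitive is the integral over the segment from a base point. Its increment between two points is
  the integral over the segment joining them: the matrix elements have scalar primitives, for which this
  is clear, and matrix elements determine an operator. Continuity of \<open>H\<close> then gives the derivative.
\<close>

lemma weakly_holomorphic_primitive:
  fixes H :: "complex \<Rightarrow> 'a::chilbert_space bop"
  assumes H: "weakly_holomorphic_on H S" and S: "convex S" "open S"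
  obtains G where "\<And>z. z \<in> S \<Longrightarrow> (G has_derivative (\<lambda>h. h *\<^sub>C H z)) (at z)"
proof (cases "S = {}")
  case False
  then obtain a where a: "a \<in> S" by blast
  define I where "I = (\<lambda>b c. integral {0..1} (\<lambda>s. (c - b) *\<^sub>C H (linepath b c s)))"
  have cont: "continuous_on S H" using H by (simp add: weakly_holomorphic_on_def)
  have seg: "closed_segment b c \<subseteq> S" if "b \<in> S" "c \<in> S" for b c
    using S(1) that by (simp add: closed_segment_subset)
  have additive: "I a c - I a b = I b c" if "b \<in> S" "c \<in> S" for b c
  proof (rule bop_eq_matrix_elementsI)
    fix x y
    have "(\<lambda>z. cinner (bop_apply (H z) x) y) holomorphic_on S"
      using H by (simp add: weakly_holomorphic_on_def)
    then obtain g where g: "\<And>z. z \<in> S \<Longrightarrow> (g has_field_derivative cinner (bop_apply (H z) x) y) (at z within S)"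
      using holomorphic_convex_primitive' [OF S] by blast
    have I: "cinner (bop_apply (I b c) x) y = g c - g b" if "b \<in> S" "c \<in> S" for b c
      unfolding I_def using segment_integral_from_primitive [OF cont seg [OF that] g] .
    show "cinner (bop_apply (I a c - I a b) x) y = cinner (bop_apply (I b c) x) y"
      using that a by (simp add: cinner_diff_left I)
  qed
  have "(I a has_derivative (\<lambda>h. h *\<^sub>C H z)) (at z)" if z: "z \<in> S" for z
    unfolding has_derivative_at_alt
  proof (intro conjI allI impI)
    show "bounded_linear (\<lambda>h. h *\<^sub>C H z)"
      by (rule bounded_bilinear.bounded_linear_left [OF bounded_bilinear_scaleC])
    fix e :: real assume "e > 0"
    obtain r where r: "r > 0" "ball z r \<subseteq> S"
      using S(2) z openE by blast
    obtain d where d: "d > 0" "\<And>w. w \<in> S \<Longrightarrow> dist w z < d \<Longrightarrow> dist (H w) (H z) < e"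
      using cont z \<open>e > 0\<close> unfolding continuous_on_iff by metis
    have "norm (I a w - I a z - (w - z) *\<^sub>C H z) \<le> e * norm (w - z)"
      if "norm (w - z) < min r d" for w
    proof -
      have w: "w \<in> S" using that r(2) by (auto simp: dist_norm norm_minus_commute)
      have cont_wz: "continuous_on {0..1} (\<lambda>s. (w - z) *\<^sub>C H (linepath z w s))"
        by (intro bounded_bilinear.continuous_on [OF bounded_bilinear_scaleC] continuous_on_const
            continuous_on_segment_integrand [OF cont] seg z w)
      have "I a w - I a z - (w - z) *\<^sub>C H z
          = integral {0..1} (\<lambda>s. (w - z) *\<^sub>C H (linepath z w s)) - integral {0..1::real} (\<lambda>s. (w - z) *\<^sub>C H z)"
        using additive [OF z w] by (simp add: I_def)
      also have "\<dots> = integral {0..1} (\<lambda>s. (w - z) *\<^sub>C H (linepath z w s) - (w - z) *\<^sub>C H z)"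
        by (rule integral_diff [symmetric]) (auto intro: integrable_continuous_real cont_wz)
      finally have "norm (I a w - I a z - (w - z) *\<^sub>C H z)
          = norm (integral {0..1} (\<lambda>s. (w - z) *\<^sub>C H (linepath z w s) - (w - z) *\<^sub>C H z))"
        by simp
      also have "\<dots> \<le> (cmod (w - z) * e) * (1 - 0)"
      proof (rule integral_bound)
        show "continuous_on {0..1} (\<lambda>s. (w - z) *\<^sub>C H (linepath z w s) - (w - z) *\<^sub>C H z)"
          by (intro continuous_on_diff cont_wz continuous_on_const)
        fix s :: real assume s: "s \<in> {0..1}"
        have "linepath z w s \<in> closed_segment z w" using s by (rule linepath_in_path)
        then have "linepath z w s \<in> S" "dist (linepath z w s) z < d"
          using seg [OF z w] that dist_in_closed_segment [of "linepath z w s" z w]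
          by (auto simp: dist_norm norm_minus_commute)
        then have "norm (H (linepath z w s) - H z) \<le> e"
          using d(2) by (force simp: dist_norm)
        then have "cmod (w - z) * norm (H (linepath z w s) - H z) \<le> cmod (w - z) * e"
          by (intro mult_left_mono) simp_all
        then show "norm ((w - z) *\<^sub>C H (linepath z w s) - (w - z) *\<^sub>C H z) \<le> cmod (w - z) * e"
          using norm_scaleC_bop_le [of "w - z" "H (linepath z w s) - H z"]
          by (simp add: bounded_bilinear.diff_right [OF bounded_bilinear_scaleC])
      qed simp
      finally show ?thesis by (simp add: mult.commute)
    qed
    then show "\<exists>d>0. \<forall>w. norm (w - z) < d \<longrightarrow> norm (I a w - I a z - (w - z) *\<^sub>C H z) \<le> e * norm (w - z)"
      using r d by (intro exI [of _ "min r d"]) auto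
  qed
  then show ?thesis by (rule that)
qed (use that in auto)

text \<open>
  The derivative of a valid path may be unbounded near the exceptional points, so the integrand need not be
  piecewise continuous up to them. Locally it is the derivative of \<open>G \<circ> \<gamma>\<close> for a primitive \<open>G\<close>, and the
  fundamental theorem of calculus for the Henstock--Kurzweil integral tolerates finitely many bad points.
\<close>

lemma bop_contour_integrable:
  fixes H :: "complex \<Rightarrow> 'a::chilbert_space bop"
  assumes H: "weakly_holomorphic_on H S" and S: "open S"
    and \<gamma>: "valid_path \<gamma>" "path_image \<gamma> \<subseteq> S"
  shows "(\<lambda>t. vector_derivative \<gamma> (at t within {0..1}) *\<^sub>C H (\<gamma> t)) integrable_on {0..1}"
proof -
  obtain N D where N: "finite N" and D: "\<And>t. t \<in> {0..1} - N \<Longrightarrow> (\<gamma> has_vector_derivative D t) (at t)"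
    using \<gamma>(1) unfolding valid_path_def piecewise_C1_differentiable_on_def C1_differentiable_on_def by metis
  have cont: "continuous_on {0..1} \<gamma>"
    using valid_path_imp_path [OF \<gamma>(1)] by (simp add: path_def)
  have "(\<lambda>t. vector_derivative \<gamma> (at t within {0..1}) *\<^sub>C H (\<gamma> t)) integrable_on cbox 0 1"
  proof (rule integrable_on_little_subintervals, intro ballI)
    fix t :: real assume t: "t \<in> cbox 0 1"
    then have "\<gamma> t \<in> S" using \<gamma>(2) by (auto simp: path_image_def)
    then obtain r where r: "r > 0" "ball (\<gamma> t) r \<subseteq> S" using S openE by blast
    obtain d where d: "d > 0" "\<And>s. s \<in> {0..1} \<Longrightarrow> dist s t < d \<Longrightarrow> dist (\<gamma> s) (\<gamma> t) < r"
      using cont t r(1) unfolding continuous_on_iff by (metis cbox_interval)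
    have "weakly_holomorphic_on H (ball (\<gamma> t) r)"
      using H r(2) unfolding weakly_holomorphic_on_def
      by (meson continuous_on_subset holomorphic_on_subset)
    then obtain G where G: "\<And>z. z \<in> ball (\<gamma> t) r \<Longrightarrow> (G has_derivative (\<lambda>h. h *\<^sub>C H z)) (at z)"
      using weakly_holomorphic_primitive by (metis convex_ball open_ball)
    have "(\<lambda>t. vector_derivative \<gamma> (at t within {0..1}) *\<^sub>C H (\<gamma> t)) integrable_on cbox u v"
      if uv: "t \<in> cbox u v" "cbox u v \<subseteq> ball t d" "cbox u v \<subseteq> cbox 0 1" for u v
    proof -
      have near: "\<gamma> s \<in> ball (\<gamma> t) r" if "s \<in> {u..v}" for s
        using d(2) [of s] that uv by (auto simp: dist_commute subset_iff)
      have "((\<lambda>t. vector_derivative \<gamma> (at t within {0..1}) *\<^sub>C H (\<gamma> t)) has_integral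
          ((G \<circ> \<gamma>) v - (G \<circ> \<gamma>) u)) {u..v}"
      proof (rule fundamental_theorem_of_calculus_interior_strong [OF N])
        show "u \<le> v" using uv(1) by simp
        fix s assume s: "s \<in> {u<..<v} - N"
        then have s01: "s \<in> {0..1} - N" using uv(3) by (auto simp: subset_iff)
        have "((G \<circ> \<gamma>) has_vector_derivative D s *\<^sub>C H (\<gamma> s)) (at s)"
          by (rule vector_derivative_diff_chain_within [OF D [OF s01]])
             (use s near in \<open>auto intro!: has_derivative_at_withinI G\<close>)
        moreover have "vector_derivative \<gamma> (at s within {0..1}) = D s"
          using D [OF s01] s01 by (intro vector_derivative_at_within_ivl) auto
        ultimately show "((G \<circ> \<gamma>) has_vector_derivative
            vector_derivative \<gamma> (at s within {0..1}) *\<^sub>C H (\<gamma> s)) (at s)"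
          by simp
      next
        have "continuous_on (ball (\<gamma> t) r) G"
          by (intro continuous_at_imp_continuous_on ballI has_derivative_continuous [OF G])
        moreover have "continuous_on {u..v} \<gamma>"
          by (rule continuous_on_subset [OF cont]) (use uv(3) \<open>t \<in> cbox u v\<close> in auto)
        ultimately show "continuous_on {u..v} (G \<circ> \<gamma>)"
          using near by (intro continuous_on_compose) (auto intro: continuous_on_subset)
      qed
      then show ?thesis by (auto simp: integrable_on_def)
    qed
    then show "\<exists>d>0. \<forall>u v. t \<in> cbox u v \<and> cbox u v \<subseteq> ball t d \<and> cbox u v \<subseteq> cbox 0 1 \<longrightarrow>
        (\<lambda>t. vector_derivative \<gamma> (at t within {0..1}) *\<^sub>C H (\<gamma> t)) integrable_on cbox u v"
      using d(1) by blast
  qed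
  then show ?thesis by simp
qed

lemma bop_contour_integral_element:
  fixes H :: "complex \<Rightarrow> 'a::chilbert_space bop"
  assumes "weakly_holomorphic_on H S" and "open S" and "valid_path \<gamma>" "path_image \<gamma> \<subseteq> S"
  shows "cinner (bop_apply (bop_contour_integral \<gamma> H) x) y
    = contour_integral \<gamma> (\<lambda>z. cinner (bop_apply (H z) x) y)"
proof -
  note int = bop_contour_integrable [OF assms]
  have "(\<lambda>z. cinner (bop_apply (H z) x) y) contour_integrable_on \<gamma>"
    using assms by (intro contour_integrable_holomorphic_simple) (auto simp: weakly_holomorphic_on_def)
  from has_contour_integral_integral [OF this]
  have "((\<lambda>t. cinner (bop_apply (H (\<gamma> t)) x) y * vector_derivative \<gamma> (at t within {0..1}))
      has_integral contour_integral \<gamma> (\<lambda>z. cinner (bop_apply (H z) x) y)) {0..1}"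
    by (simp only: has_contour_integral_def)
  moreover have "((\<lambda>t. cinner (bop_apply (vector_derivative \<gamma> (at t within {0..1}) *\<^sub>C H (\<gamma> t)) x) y)
      has_integral cinner (bop_apply (bop_contour_integral \<gamma> H) x) y) {0..1}"
    unfolding bop_contour_integral_def
    using has_integral_linear [OF integrable_integral [OF int] bounded_linear_matrix_element, of x y]
    by (simp only: o_def)
  ultimately show ?thesis
    by (simp add: cinner_scaleC_left mult.commute has_integral_unique)
qed

section \<open>Deforming the contour to a circle\<close>

text \<open>
  The set \<open>unit_disc - K\<close> may be disconnected, but the contour and the circle lie in one component.
  By the Jordan curve theorem the closure of the outside of \<open>\<gamma>\<close> is the outside together with \<open>\<gamma>\<close>; it is
  connected and misses \<open>K\<close>. Its retraction onto the closed disc of radius \<open>r\<close> is still connected, contains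
  \<open>\<gamma>\<close> and the circle, and still misses \<open>K\<close>, since it moves points only onto the circle.
\<close>

lemma surrounding_contour_reaches_circle:
  assumes \<gamma>: "surrounds \<gamma> K unit_disc" and r: "0 < r" "r < 1" "path_image \<gamma> \<subseteq> ball 0 r"
  shows "K \<subseteq> ball 0 r"
    and "connected_component (unit_disc - K) (pathstart \<gamma>) (of_real r)"
proof -
  have sp: "simple_path \<gamma>" "pathfinish \<gamma> = pathstart \<gamma>" and K: "K \<subseteq> inside (path_image \<gamma>)"
    using \<gamma> by (auto simp: surrounds_def)
  note jordan = Jordan_inside_outside [OF sp]
  have far: "- ball 0 r \<subseteq> outside (path_image \<gamma>)"
    using r by (intro outside_subset_convex) auto
  show Kr: "K \<subseteq> ball 0 r"
    using far K jordan by blast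
  define T where "T = closure (outside (path_image \<gamma>))"
  have T: "T = outside (path_image \<gamma>) \<union> path_image \<gamma>"
    using jordan by (simp add: T_def closure_Un_frontier)
  have TK: "T \<inter> K = {}"
    using K inside_no_overlap [of "path_image \<gamma>"] jordan unfolding T by blast
  define \<rho> where "\<rho> = closest_point (cball (0::complex) r)"
  have ne: "cball (0::complex) r \<noteq> {}" using r by simp
  have "connected (\<rho> ` T)"
    unfolding \<rho>_def T_def
    by (intro connected_continuous_image continuous_on_closest_point convex_cball closed_cball ne
        connected_imp_connected_closure) (use jordan in auto)
  moreover have "\<rho> ` T \<subseteq> unit_disc - K"
  proof (rule image_subsetI)
    fix z assume z: "z \<in> T"
    have "\<rho> z \<in> cball 0 r"
      unfolding \<rho>_def by (rule closest_point_in_set [OF closed_cball ne])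
    moreover have "\<rho> z \<notin> K"
    proof (cases "z \<in> cball 0 r")
      case True
      then have "\<rho> z = z" by (simp add: \<rho>_def closest_point_self)
      then show ?thesis using z TK by auto
    next
      case False
      have int: "interior (cball (0::complex) r) \<noteq> {}" using r by simp
      have "\<rho> z \<in> rel_frontier (cball 0 r)"
        unfolding \<rho>_def
        by (rule closest_point_in_rel_frontier [OF closed_cball ne])
           (use False in \<open>simp add: affine_hull_nonempty_interior [OF int] rel_interior_nonempty_interior [OF int]\<close>)
      then have "\<rho> z \<in> sphere 0 r"
        using r by (simp add: rel_frontier_nonempty_interior [OF int])
      then show ?thesis using Kr by auto
    qed
    ultimately show "\<rho> z \<in> unit_disc - K" using r by auto
  qed
  moreover have "pathstart \<gamma> \<in> \<rho> ` T"
  proof (rule image_eqI)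
    show "pathstart \<gamma> \<in> T" unfolding T using pathstart_in_path_image by blast
    then show "pathstart \<gamma> = \<rho> (pathstart \<gamma>)"
      using r(3) pathstart_in_path_image [of \<gamma>] by (auto simp: \<rho>_def closest_point_self)
  qed
  moreover have "of_real r \<in> \<rho> ` T"
  proof (rule image_eqI)
    show "of_real r \<in> T" using far r by (auto simp: T)
    then show "of_real r = \<rho> (of_real r)"
      using r by (auto simp: \<rho>_def closest_point_self)
  qed
  ultimately show "connected_component (unit_disc - K) (pathstart \<gamma>) (of_real r)"
    unfolding connected_component_def by blast
qed

text \<open>
  Joining contour and reversed circle by a path back and forth yields a closed path in \<open>unit_disc - K\<close> whose
  winding number vanishes off that set: around points of \<open>K\<close> the contributions \<open>1\<close> and \<open>-1\<close> cancel, and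
  points off the disc are not encircled at all.
\<close>

lemma contour_integral_surrounding_eq_circle:
  assumes \<gamma>: "surrounds \<gamma> K unit_disc" and K: "closed K"
    and r: "0 < r" "r < 1" "path_image \<gamma> \<subseteq> ball 0 r"
    and h: "h holomorphic_on unit_disc - K"
  shows "contour_integral \<gamma> h = contour_integral (circlepath 0 r) h"
proof -
  let ?S = "unit_disc - K" and ?c = "circlepath 0 r"
  note reach = surrounding_contour_reaches_circle [OF \<gamma> r]
  have S: "open ?S" using K by (intro open_Diff) auto
  have vp: "valid_path \<gamma>" and loop: "pathfinish \<gamma> = pathstart \<gamma>" and in_disc: "path_image \<gamma> \<subseteq> unit_disc"
    and Kin: "K \<subseteq> inside (path_image \<gamma>)" and wn: "\<And>z. z \<in> inside (path_image \<gamma>) \<Longrightarrow> winding_number \<gamma> z = 1"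
    using \<gamma> by (auto simp: surrounds_def)
  have \<gamma>S: "path_image \<gamma> \<subseteq> ?S"
    using in_disc Kin inside_no_overlap [of "path_image \<gamma>"] by blast
  have cS: "path_image ?c \<subseteq> ?S"
    using r reach(1) by auto
  let ?C = "connected_component_set ?S (pathstart \<gamma>)"
  have "open ?C" "connected ?C" using S by (auto intro: open_connected_component)
  moreover have "pathstart \<gamma> \<in> ?C" using \<gamma>S pathstart_in_path_image [of \<gamma>] by auto
  moreover have "of_real r \<in> ?C" using reach(2) by simp
  ultimately obtain p where p: "polynomial_function p" "path_image p \<subseteq> ?C"
      "pathstart p = pathstart \<gamma>" "pathfinish p = of_real r"
    using connected_open_polynomial_connected by metis
  then have vpp: "valid_path p" by (simp add: valid_path_polynomial_function)
  have pS: "path_image p \<subseteq> ?S" using p(2) connected_component_subset by (rule order_trans)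
  have c0: "pathstart ?c = of_real r" "pathfinish ?c = of_real r"
    by (simp_all add: circlepath pathstart_def pathfinish_def)
  let ?\<Gamma> = "(\<gamma> +++ p) +++ (reversepath ?c +++ reversepath p)"
  note paths = valid_path_imp_path [OF vp] valid_path_imp_path [OF vpp]
  have integrable: "(h has_contour_integral contour_integral g h) g"
    if "valid_path g" "path_image g \<subseteq> ?S" for g
    using that by (intro has_contour_integral_integral contour_integrable_holomorphic_simple [OF h S])
  have "(h has_contour_integral ((contour_integral \<gamma> h + contour_integral p h)
      + (- contour_integral ?c h + - contour_integral p h))) ?\<Gamma>"
    by (intro has_contour_integral_join has_contour_integral_reversepath integrable
        valid_path_join vp vpp \<gamma>S pS cS valid_path_circlepath valid_path_imp_reverse) (simp_all add: p c0 loop)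
  moreover have "(h has_contour_integral 0) ?\<Gamma>"
  proof (rule Cauchy_theorem_global [OF S h])
    show "valid_path ?\<Gamma>"
      by (intro valid_path_join vp vpp valid_path_circlepath valid_path_imp_reverse) (simp_all add: p c0 loop)
    show "pathfinish ?\<Gamma> = pathstart ?\<Gamma>" by (simp add: p)
    show "path_image ?\<Gamma> \<subseteq> ?S"
      using \<gamma>S pS cS by (simp add: path_image_join p c0 loop)
    fix w assume w: "w \<notin> ?S"
    then have notin: "w \<notin> path_image \<gamma>" "w \<notin> path_image p" "w \<notin> path_image ?c"
      using \<gamma>S pS cS by blast+
    then have "winding_number ?\<Gamma> w = winding_number \<gamma> w - winding_number ?c w"
      using paths by (simp add: winding_number_join winding_number_reversepath path_image_join p c0 loop del: path_image_circlepath)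
    also have "winding_number \<gamma> w = winding_number ?c w"
    proof (cases "w \<in> K")
      case True
      then have "w \<in> ball 0 r" using reach(1) by blast
      then have "winding_number ?c w = 1" by (intro winding_number_circlepath) simp
      then show ?thesis using wn Kin True by auto
    next
      case False
      then have "w \<notin> unit_disc" using w by blast
      then show ?thesis
        using winding_number_zero_outside [OF paths(1) convex_ball loop, of w 0 1] in_disc
          winding_number_zero_outside [OF path_circlepath convex_ball, of 0 r w 0 1] cS c0 by auto
    qed
    finally show "winding_number ?\<Gamma> w = 0" by simp
  qed
  ultimately have "(contour_integral \<gamma> h + contour_integral p h)
      + (- contour_integral ?c h + - contour_integral p h) = 0"
    by (rule has_contour_integral_unique)
  then show ?thesis by simp
qed

lemma surrounds_circlepath:
  assumes "0 < r" "r < 1" "K \<subseteq> ball 0 r"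
  shows "surrounds (circlepath 0 r) K unit_disc"
proof -
  have "inside (path_image (circlepath 0 r)) = ball 0 r"
    using inside_frontier_eq_interior [of "cball (0::complex) r"] assms by simp
  then show ?thesis
    using assms unfolding surrounds_def
    by (auto simp: simple_path_circlepath winding_number_circlepath)
qed


section \<open>The functional calculus as an average over a circle\<close>

lemma circle_mean_value:
  assumes "continuous_on (cball 0 1) g" and "g holomorphic_on ball 0 1"
  shows "((\<lambda>t. g (circlepath 0 1 t)) has_integral g 0) {0..1}"
proof -
  have "((\<lambda>u. g u / (u - 0)) has_contour_integral (2 * of_real pi * \<i> * g 0)) (circlepath 0 1)"
    by (rule Cauchy_integral_circlepath) (use assms in auto)
  then have "((\<lambda>t. g (circlepath 0 1 t) / circlepath 0 1 t * (2 * pi * \<i> * circlepath 0 1 t))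
      has_integral (2 * of_real pi * \<i> * g 0)) {0..1}"
    by (simp add: has_contour_integral vector_derivative_circlepath) (simp add: circlepath)
  moreover have "circlepath 0 1 t \<noteq> 0" for t by (simp add: circlepath)
  ultimately have "((\<lambda>t. 2 * of_real pi * \<i> * g (circlepath 0 1 t)) has_integral (2 * of_real pi * \<i> * g 0)) {0..1}"
    by (simp add: mult_ac)
  from has_integral_mult_right [OF this, of "1 / (2 * of_real pi * \<i>)"]
  show ?thesis by simp
qed

lemma class_A_mean_Re:
  assumes f: "f \<in> class_A" and r: "0 < r" "r < 1"
  shows "((\<lambda>t. Re (f (circlepath 0 r t))) has_integral 1) {0..1}"
proof -
  define g where "g = f \<circ> (\<lambda>z. of_real r * z)"
  have "g holomorphic_on cball 0 1"
    unfolding g_def using r f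
    by (intro holomorphic_on_compose_gen [of _ _ f unit_disc] holomorphic_intros)
       (auto simp: norm_mult class_A_def analytic_imp_holomorphic intro!: le_less_trans [OF mult_left_le, of _ r])
  then have "((\<lambda>t. g (circlepath 0 1 t)) has_integral g 0) {0..1}"
    by (intro circle_mean_value) (auto intro: holomorphic_on_imp_continuous_on holomorphic_on_subset)
  from has_integral_linear [OF this bounded_linear_Re]
  show ?thesis using f by (simp add: g_def o_def circlepath class_A_def)
qed

lemma has_integral_contour_integral_circle:
  assumes "g contour_integrable_on circlepath 0 r"
  shows "((\<lambda>t. g (circlepath 0 r t) * circlepath 0 r t) has_integral
    1 / (2 * of_real pi * \<i>) * contour_integral (circlepath 0 r) g) {0..1}"
proof -
  have "((\<lambda>t. g (circlepath 0 r t) * (2 * pi * \<i> * circlepath 0 r t))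
      has_integral contour_integral (circlepath 0 r) g) {0..1}"
    using has_contour_integral_integral [OF assms]
    by (simp add: has_contour_integral vector_derivative_circlepath) (simp add: circlepath mult_ac)
  from has_integral_mult_right [OF this, of "1 / (2 * of_real pi * \<i>)"]
  show ?thesis by (simp add: mult_ac)
qed

lemma compact_in_ball_shrink:
  fixes K :: "complex set"
  assumes "compact K" "K \<subseteq> unit_disc"
  obtains r where "0 < r" "r < 1" "K \<subseteq> ball 0 r"
proof (cases "K = {}")
  case True
  then show ?thesis using that [of "1/2"] by simp
next
  case False
  then obtain z where z: "z \<in> K" "\<And>w. w \<in> K \<Longrightarrow> norm w \<le> norm z"
    using continuous_attains_sup [OF assms(1), of norm] continuous_on_norm_id by blast
  have "norm z < 1" using z(1) assms(2) by auto
  then have "K \<subseteq> ball 0 ((norm z + 1) / 2)" using z(2) by force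
  then show ?thesis
    using that [of "(norm z + 1) / 2"] \<open>norm z < 1\<close> by (simp add: add_nonneg_pos)
qed

text \<open>
  The operator analogue of \<open>(w + z) / (w - z)\<close>. The resolvent stands on the left so that the adjoint
  of the kernel is directly \<open>(cnj w + T\<^sup>*) R(w)\<^sup>*\<close>.
\<close>

definition herglotz_kernel :: "'a::chilbert_space bop \<Rightarrow> complex \<Rightarrow> 'a bop"
  where "herglotz_kernel T w = resolvent T w * (w *\<^sub>C 1 + T)"

lemma herglotz_kernel_element:
  fixes T :: "'a::chilbert_space bop"
  assumes "w \<notin> spectrum T"
  shows "cinner (bop_apply (herglotz_kernel T w) x) y
    = 2 * (w * cinner (bop_apply (resolvent T w) x) y) - cinner x y"
proof -
  have "resolvent T w * T = w *\<^sub>C resolvent T w - 1"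
    using resolvent_inverse(1) [OF assms] by (simp add: right_diff_distrib scaleC_mult_bop algebra_simps)
  then have "herglotz_kernel T w = w *\<^sub>C resolvent T w + (w *\<^sub>C resolvent T w - 1)"
    by (simp add: herglotz_kernel_def distrib_left scaleC_mult_bop)
  then show ?thesis
    by (simp add: cinner_linear)
qed

text \<open>
  On the circle \<open>|z| = r\<close> the conjugate of the integrand is the boundary value of
  \<open>g(u) = f(r u) cnj (\<theta> (cnj u))\<close>, where \<open>\<theta>(u) = \<phi>(r / u)\<close> and \<open>\<phi>(z) = \<langle>z R(z) x, y\<rangle>\<close>: on the unit circle
  \<open>r / cnj u = r u\<close>. Since \<open>\<phi>\<close> tends to \<open>\<langle>x, y\<rangle>\<close> at infinity, \<open>\<theta>\<close> has a removable
  singularity at \<open>0\<close>, and the mean value of \<open>g\<close> is \<open>g(0) = cnj \<langle>x, y\<rangle>\<close>.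
\<close>

lemma resolvent_reflected_mean:
  fixes T :: "'a::chilbert_space bop"
  assumes T: "G1_operator T" "(1 :: 'a bop) \<noteq> 0" "spectrum T \<subseteq> ball 0 s"
    and s: "0 < s" "s < r" "r < 1" and f: "f holomorphic_on unit_disc" "f 0 = 1"
  shows "((\<lambda>t. cnj (f (circlepath 0 r t)) * (circlepath 0 r t * cinner (bop_apply (resolvent T (circlepath 0 r t)) x) y))
    has_integral cinner x y) {0..1}"
proof -
  define \<phi> where "\<phi> = (\<lambda>z. z * cinner (bop_apply (resolvent T z) x) y)"
  define \<theta> where "\<theta> = (\<lambda>u. if u = 0 then cinner x y else \<phi> (of_real r / u))"
  \<comment> \<open>The radius of a disc on which both factors of \<open>g\<close> are defined; it exceeds \<open>1\<close> because \<open>r < 1\<close> and \<open>s < r\<close>.\<close>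
  define q where "q = min (1 / r) (r / s)"
  have q: "q > 1" using s by (simp add: q_def)
  have \<phi>_hol: "\<phi> holomorphic_on - spectrum T"
    unfolding \<phi>_def by (intro holomorphic_intros holomorphic_resolvent_element T)
  have \<theta>_hol0: "\<theta> holomorphic_on ball 0 q - {0}"
  proof (rule holomorphic_transform)
    have "of_real r / u \<in> - spectrum T" if "u \<in> ball 0 q - {0}" for u :: complex
    proof -
      have "cmod u * s < r" using that s by (simp add: q_def field_simps)
      then have "s < cmod (of_real r / u)" using that s by (simp add: norm_divide field_simps)
      then show ?thesis using T(3) by auto
    qed
    then have "\<phi> \<circ> (\<lambda>u. of_real r / u) holomorphic_on ball 0 q - {0}"
      by (intro holomorphic_on_compose_gen [OF _ \<phi>_hol] holomorphic_intros) auto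
    then show "(\<lambda>u. \<phi> (of_real r / u)) holomorphic_on ball 0 q - {0}" by (simp add: o_def)
  qed (simp add: \<theta>_def)
  have \<theta>_lim: "(\<theta> \<longlongrightarrow> cinner x y) (at 0)"
  proof (rule Lim_transform_eventually)
    have "filterlim (\<lambda>u. of_real r * inverse u :: complex) at_infinity (at 0)"
      using s by (intro tendsto_mult_filterlim_at_infinity [OF tendsto_const] filterlim_inverse_at_infinity) auto
    moreover have "(\<phi> \<longlongrightarrow> cinner x y) at_infinity"
      unfolding \<phi>_def using T s G1_spectrum_nonempty
      by (intro resolvent_at_infinity) (auto intro: order_trans [OF T(3)])
    ultimately show "((\<lambda>u. \<phi> (of_real r * inverse u)) \<longlongrightarrow> cinner x y) (at 0)"
      by (rule filterlim_compose [rotated])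
    show "\<forall>\<^sub>F u in at 0. \<phi> (of_real r * inverse u) = \<theta> u"
      using eventually_neq_at_within [of 0 0 UNIV] by (rule eventually_mono) (simp add: \<theta>_def divide_inverse)
  qed
  have \<theta>_hol: "\<theta> holomorphic_on ball 0 q"
  proof (rule no_isolated_singularity)
    have "isCont \<theta> u" if "u \<in> ball 0 q" for u
    proof (cases "u = 0")
      case True
      then show ?thesis using \<theta>_lim by (simp add: isCont_def \<theta>_def)
    next
      case False
      have "open (ball (0::complex) q - {0})" by (simp add: open_Diff)
      then show ?thesis
        using False that holomorphic_on_imp_continuous_on [OF \<theta>_hol0]
        by (simp add: continuous_on_eq_continuous_at)
    qed
    then show "continuous_on (ball 0 q) \<theta>" by (simp add: continuous_at_imp_continuous_on)
  qed (use \<theta>_hol0 in auto)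
  define g where "g = (\<lambda>z. f (of_real r * z) * (cnj \<circ> \<theta> \<circ> cnj) z)"
  have "cnj ` ball 0 q = ball 0 q"
    by (auto simp: image_cnj_conv_vimage_cnj)
  then have "cnj \<circ> \<theta> \<circ> cnj holomorphic_on ball 0 q"
    using \<theta>_hol by (intro holomorphic_on_compose_cnj_cnj) auto
  moreover have "(f \<circ> (\<lambda>z. of_real r * z)) holomorphic_on ball 0 q"
    using s by (intro holomorphic_on_compose_gen [OF _ f(1)] holomorphic_intros)
      (auto simp: q_def norm_mult field_simps)
  ultimately have g_hol: "g holomorphic_on ball 0 q"
    unfolding g_def by (intro holomorphic_intros) (simp_all add: o_def)
  have "((\<lambda>t. g (circlepath 0 1 t)) has_integral g 0) {0..1}"
  proof (rule circle_mean_value)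
    show "continuous_on (cball 0 1) g"
      using q by (intro holomorphic_on_imp_continuous_on holomorphic_on_subset [OF g_hol]) auto
    show "g holomorphic_on ball 0 1"
      using q by (intro holomorphic_on_subset [OF g_hol]) auto
  qed
  then have "((\<lambda>t. cnj (g (circlepath 0 1 t))) has_integral cnj (g 0)) {0..1}"
    using has_integral_linear [OF _ bounded_linear_cnj] by (simp add: o_def)
  moreover have "cnj (g (circlepath 0 1 t)) = cnj (f (circlepath 0 r t)) * \<phi> (circlepath 0 r t)" for t
  proof -
    define e where "e = circlepath 0 1 t"
    have e: "e * cnj e = 1" "e \<noteq> 0"
      by (simp_all add: e_def circlepath exp_cnj flip: exp_add)
    have "circlepath 0 r t = of_real r * e" by (simp add: e_def circlepath)
    moreover have "of_real r / cnj e = of_real r * e"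
      using e by (simp add: field_simps)
    ultimately show ?thesis
      using e by (simp add: g_def \<theta>_def flip: e_def)
  qed
  ultimately show ?thesis
    by (simp add: g_def \<theta>_def \<phi>_def f(2))
qed

text \<open>
  With \<open>H(w) = 2 w R(w) - 1\<close> and \<open>2 Re f = f + cnj f\<close>, the integrand is
  \<open>f(w) w R(w) + cnj (f(w)) w R(w) - Re f(w)\<close>. The means of the three terms are \<open>f(T)\<close>, \<open>1\<close> and \<open>1\<close>.
  The radius must exceed \<open>r\<^sub>0\<close> for the circle to enclose both the spectrum and the contour chosen in the
  definition of the calculus.
\<close>

lemma disc_calculus_average:
  fixes T :: "'a::chilbert_space bop"
  assumes T: "G1_operator T" "(1 :: 'a bop) \<noteq> 0" "spectrum T \<subseteq> unit_disc" and f: "f \<in> class_A"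
  obtains r\<^sub>0 where "0 < r\<^sub>0" "r\<^sub>0 < 1"
    and "\<And>r x y. r\<^sub>0 < r \<Longrightarrow> r < 1 \<Longrightarrow>
      ((\<lambda>t. of_real (Re (f (circlepath 0 r t))) * cinner (bop_apply (herglotz_kernel T (circlepath 0 r t)) x) y)
        has_integral cinner (bop_apply (disc_calculus f T) x) y) {0..1}"
proof -
  let ?K = "spectrum T"
  have f_hol: "f holomorphic_on unit_disc" and f0: "f 0 = 1"
    using f by (auto simp: class_A_def analytic_imp_holomorphic)
  have K: "closed ?K" using T by (intro G1_closed_spectrum)
  have "bounded ?K" using T(3) bounded_ball bounded_subset by blast
  then obtain s where s: "0 < s" "s < 1" "?K \<subseteq> ball 0 s"
    using compact_in_ball_shrink [of ?K] K T(3) by (auto simp: compact_eq_bounded_closed)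
  define \<gamma> where "\<gamma> = (SOME \<gamma>. surrounds \<gamma> ?K unit_disc)"
  have \<gamma>: "surrounds \<gamma> ?K unit_disc"
    unfolding \<gamma>_def by (rule someI [of _ "circlepath 0 s"]) (rule surrounds_circlepath [OF s])
  then have vp: "valid_path \<gamma>" and in_disc: "path_image \<gamma> \<subseteq> unit_disc" and Kin: "?K \<subseteq> inside (path_image \<gamma>)"
    by (auto simp: surrounds_def)
  obtain s' where s': "0 < s'" "s' < 1" "path_image \<gamma> \<subseteq> ball 0 s'"
    using compact_in_ball_shrink [OF compact_valid_path_image [OF vp] in_disc] by blast
  have avg: "((\<lambda>t. of_real (Re (f (circlepath 0 r t))) * cinner (bop_apply (herglotz_kernel T (circlepath 0 r t)) x) y)
        has_integral cinner (bop_apply (disc_calculus f T) x) y) {0..1}"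
    if r: "max s s' < r" "r < 1" for r x y
  proof -
    define \<phi> where "\<phi> = (\<lambda>z. cinner (bop_apply (resolvent T z) x) y)"
    let ?c = "circlepath 0 r"
    have r0: "0 < r" using r s by simp
    have \<gamma>r: "path_image \<gamma> \<subseteq> ball 0 r" using s'(3) r by (auto simp: subset_iff)
    have c_norm: "cmod (?c t) = r" for t using r0 by (simp add: circlepath norm_mult)
    have S: "open (unit_disc - ?K)" using K by (intro open_Diff) auto
    have H: "weakly_holomorphic_on (\<lambda>z. f z *\<^sub>C resolvent T z) (unit_disc - ?K)"
      unfolding weakly_holomorphic_on_def
    proof (intro conjI allI)
      show "continuous_on (unit_disc - ?K) (\<lambda>z. f z *\<^sub>C resolvent T z)"
        using f_hol continuous_on_resolvent [OF T(1,2)]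
        by (intro bounded_bilinear.continuous_on [OF bounded_bilinear_scaleC])
           (auto intro: continuous_on_subset holomorphic_on_imp_continuous_on)
      show "(\<lambda>z. cinner (bop_apply (f z *\<^sub>C resolvent T z) x) y) holomorphic_on unit_disc - ?K" for x y
        using f_hol holomorphic_resolvent_element [OF T(1,2), of x y]
        by (simp only: bop_apply_simps cinner_scaleC_left)
           (auto intro!: holomorphic_intros intro: holomorphic_on_subset)
    qed
    have \<gamma>S: "path_image \<gamma> \<subseteq> unit_disc - ?K"
      using in_disc Kin inside_no_overlap [of "path_image \<gamma>"] by blast
    have h_hol: "(\<lambda>z. f z * \<phi> z) holomorphic_on unit_disc - ?K"
      using H by (simp add: weakly_holomorphic_on_def cinner_scaleC_left \<phi>_def)
    have cS: "path_image ?c \<subseteq> unit_disc - ?K"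
      using s(3) r r0 by auto
    have "cinner (bop_apply (disc_calculus f T) x) y
        = 1 / (2 * of_real pi * \<i>) * contour_integral \<gamma> (\<lambda>z. f z * \<phi> z)"
      unfolding riesz_dunford_def \<gamma>_def [symmetric] \<phi>_def
      by (simp add: cinner_scaleC_left bop_contour_integral_element [OF H S vp \<gamma>S])
    also have "contour_integral \<gamma> (\<lambda>z. f z * \<phi> z) = contour_integral ?c (\<lambda>z. f z * \<phi> z)"
      by (rule contour_integral_surrounding_eq_circle [OF \<gamma> K r0 r(2) \<gamma>r h_hol])
    finally have direct: "((\<lambda>t. f (?c t) * \<phi> (?c t) * ?c t) has_integral cinner (bop_apply (disc_calculus f T) x) y) {0..1}"
      using has_integral_contour_integral_circle [OF contour_integrable_holomorphic_simple [OF h_hol S _ cS]]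
      by simp
    have reflected: "((\<lambda>t. cnj (f (?c t)) * (?c t * \<phi> (?c t))) has_integral cinner x y) {0..1}"
      unfolding \<phi>_def using r s(1,3) by (intro resolvent_reflected_mean [OF T(1,2) s(3)] f_hol f0) auto
    have "((\<lambda>t. of_real (Re (f (?c t))) :: complex) has_integral of_real 1) {0..1}"
      using has_integral_linear [OF class_A_mean_Re [OF f r0 r(2)] bounded_linear_of_real]
      by (simp add: o_def)
    from has_integral_mult_left [OF this, of "cinner x y"]
    have mass: "((\<lambda>t. of_real (Re (f (?c t))) * cinner x y) has_integral cinner x y) {0..1}"
      by simp
    have "((\<lambda>t. (f (?c t) * \<phi> (?c t) * ?c t + cnj (f (?c t)) * (?c t * \<phi> (?c t))) - of_real (Re (f (?c t))) * cinner x y)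
      has_integral (cinner (bop_apply (disc_calculus f T) x) y + cinner x y - cinner x y)) {0..1}"
      by (intro has_integral_diff has_integral_add direct reflected mass)
    moreover have "(f (?c t) * \<phi> (?c t) * ?c t + cnj (f (?c t)) * (?c t * \<phi> (?c t))) - of_real (Re (f (?c t))) * cinner x y
      = of_real (Re (f (?c t))) * cinner (bop_apply (herglotz_kernel T (?c t)) x) y" for t
    proof -
      have "?c t \<notin> ?K" using s(3) r c_norm [of t] by force
      moreover have "of_real (Re (f (?c t))) * 2 = f (?c t) + cnj (f (?c t))"
        by (simp add: complex_add_cnj)
      ultimately show ?thesis
        by (simp add: herglotz_kernel_element \<phi>_def right_diff_distrib mult.assoc [symmetric])
           (simp add: algebra_simps)
    qed
    ultimately show ?thesis by simp
  qed
  show ?thesis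
    by (rule that [of "max s s'"]) (use s s' avg in auto)
qed


section \<open>Numerical radius of the averaged forms\<close>

lemma averaged_bound:
  fixes F :: "real \<Rightarrow> complex"
  assumes F: "((\<lambda>t. of_real (p t) * F t) has_integral I) {0..1}"
    and p: "(p has_integral 1) {0..1}" "\<And>t. t \<in> {0..1} \<Longrightarrow> 0 \<le> p t"
    and bound: "\<And>t. t \<in> {0..1} \<Longrightarrow> cmod (F t + c) \<le> C"
  shows "cmod (I + c) \<le> C"
proof -
  have "((\<lambda>t. of_real (p t) :: complex) has_integral of_real 1) {0..1}"
    using has_integral_linear [OF p(1) bounded_linear_of_real] by (simp add: o_def)
  from has_integral_mult_left [OF this, of c] F
  have "((\<lambda>t. of_real (p t) * F t + of_real (p t) * c) has_integral (I + c)) {0..1}"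
    by (intro has_integral_add) simp_all
  then have int: "((\<lambda>t. of_real (p t) * (F t + c)) has_integral (I + c)) {0..1}"
    by (simp add: distrib_left)
  have C: "((\<lambda>t. p t * C) has_integral C) {0..1}"
    using has_integral_mult_left [OF p(1), of C] by simp
  have "norm (integral {0..1} (\<lambda>t. of_real (p t) * (F t + c))) \<le> integral {0..1} (\<lambda>t. p t * C)"
  proof (rule integral_norm_bound_integral)
    show "norm (of_real (p t) * (F t + c)) \<le> p t * C" if "t \<in> {0..1}" for t
      using p(2) [OF that] bound [OF that] by (simp add: norm_mult mult_left_mono)
  qed (use int C in \<open>auto simp: integrable_on_def\<close>)
  then show ?thesis by (simp only: integral_unique [OF int] integral_unique [OF C])
qed

text \<open>
  The form is real-linear in the operator averaged: its second summand is, up to the factor \<open>s\<close>, the complex conjugate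
  of a matrix element of that operator, and the weight \<open>p\<close> is real.
\<close>

lemma sesquilinear_average_bound:
  fixes S X :: "'a::chilbert_space bop" and U :: "real \<Rightarrow> 'a bop"
  assumes S: "\<And>x y. ((\<lambda>t. of_real (p t) * cinner (bop_apply (U t) x) y) has_integral cinner (bop_apply S x) y) {0..1}"
    and p: "(p has_integral 1) {0..1}" "\<And>t. t \<in> {0..1} \<Longrightarrow> 0 \<le> p t"
    and bound: "\<And>t. t \<in> {0..1} \<Longrightarrow> cmod (cinner (bop_apply X w) (bop_apply (adj (U t)) v)
      + s * cinner (bop_apply X (bop_apply (adj (U t)) v)) w + c) \<le> C"
  shows "cmod (cinner (bop_apply X w) (bop_apply (adj S) v) + s * cinner (bop_apply X (bop_apply (adj S) v)) w + c) \<le> C"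
proof -
  define z where "z = bop_apply (adj X) w"
  have form: "cinner (bop_apply X w) (bop_apply (adj T) v) + s * cinner (bop_apply X (bop_apply (adj T) v)) w
      = cinner (bop_apply T (bop_apply X w)) v + s * cnj (cinner (bop_apply T z) v)" for T
  proof -
    have "cinner (bop_apply X (bop_apply (adj T) v)) w = cinner (bop_apply (adj T) v) z"
      by (simp add: cinner_adj z_def)
    also have "\<dots> = cnj (cinner (bop_apply T z) v)"
      by (simp only: cinner_adj_left cinner_commute [of v])
    finally show ?thesis by (simp add: cinner_adj)
  qed
  have "((\<lambda>t. cnj (of_real (p t) * cinner (bop_apply (U t) z) v)) has_integral cnj (cinner (bop_apply S z) v)) {0..1}"
    using has_integral_linear [OF S bounded_linear_cnj] by (simp add: o_def)
  from has_integral_add [OF S [of "bop_apply X w" v] has_integral_mult_right [OF this, of s]]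
  have "((\<lambda>t. of_real (p t) * (cinner (bop_apply X w) (bop_apply (adj (U t)) v)
      + s * cinner (bop_apply X (bop_apply (adj (U t)) v)) w)) has_integral
      (cinner (bop_apply X w) (bop_apply (adj S) v) + s * cinner (bop_apply X (bop_apply (adj S) v)) w)) {0..1}"
    by (simp add: form algebra_simps)
  then show ?thesis
    using p bound by (rule averaged_bound)
qed

text \<open>
  Since \<open>v = (cnj z\<^sub>1 - A\<^sup>*) p = (cnj z\<^sub>2 - B\<^sup>*) q\<close> while the adjoint kernels send \<open>v\<close> to
  \<open>(cnj z\<^sub>1 + A\<^sup>*) p\<close> and \<open>(cnj z\<^sub>2 + B\<^sup>*) q\<close>, adding \<open>\<langle>X v, v\<rangle>\<close> to the form
  cancels the mixed terms with a single \<open>A\<^sup>*\<close> or \<open>B\<^sup>*\<close>. One copy of \<open>\<langle>X v, v\<rangle>\<close> is needed for each summand,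
  with the sign \<open>s\<close> for the second; this is the source of \<open>(1 + s) \<langle>X v, v\<rangle>\<close>.
\<close>

lemma herglotz_kernel_form_bound:
  fixes A B X :: "'a::chilbert_space bop"
  assumes z: "z\<^sub>1 \<notin> spectrum A" "z\<^sub>2 \<notin> spectrum B" "cmod z\<^sub>1 \<le> 1" "cmod z\<^sub>2 \<le> 1"
    and res: "norm (resolvent A z\<^sub>1) \<le> a" "norm (resolvent B z\<^sub>2) \<le> b"
    and s: "s = 1 \<or> s = (- 1 :: complex)" and v: "norm v = 1"
  shows "cmod (cinner (bop_apply X (bop_apply (adj (herglotz_kernel B z\<^sub>2)) v)) (bop_apply (adj (herglotz_kernel A z\<^sub>1)) v)
      + s * cinner (bop_apply X (bop_apply (adj (herglotz_kernel A z\<^sub>1)) v)) (bop_apply (adj (herglotz_kernel B z\<^sub>2)) v)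
      + (1 + s) * cinner (bop_apply X v) v)
    \<le> 2 * (a * b) * (2 * numerical_radius X + numerical_radius (A * X * adj B + B * X * adj A)
             + numerical_radius (A * X * adj B - B * X * adj A))"
proof -
  define p where "p = bop_apply (adj (resolvent A z\<^sub>1)) v"
  define q where "q = bop_apply (adj (resolvent B z\<^sub>2)) v"
  have kernel: "bop_apply (adj (herglotz_kernel T z)) v
      = cnj z *\<^sub>C bop_apply (adj (resolvent T z)) v + bop_apply (adj T) (bop_apply (adj (resolvent T z)) v)"
    for T :: "'a bop" and z
    by (simp add: herglotz_kernel_def adj_mult_apply adj_scaleC_one_plus)
  have vector: "v = cnj z *\<^sub>C bop_apply (adj (resolvent T z)) v - bop_apply (adj T) (bop_apply (adj (resolvent T z)) v)"
    if "z \<notin> spectrum T" for T :: "'a bop" and z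
  proof -
    have "v = bop_apply (adj (resolvent T z * (z *\<^sub>C 1 - T))) v"
      by (rule cinner_eqI) (simp add: resolvent_inverse(1) [OF that] flip: cinner_adj)
    then show ?thesis by (simp add: adj_mult_apply adj_scaleC_one_minus)
  qed
  let ?U = "bop_apply (adj (herglotz_kernel A z\<^sub>1)) v" and ?V = "bop_apply (adj (herglotz_kernel B z\<^sub>2)) v"
  let ?P = "A * X * adj B" and ?Q = "B * X * adj A"
  let ?n = "norm p * norm q"
  define c where "c = z\<^sub>1 * cnj z\<^sub>2"
  have U: "?U = cnj z\<^sub>1 *\<^sub>C p + bop_apply (adj A) p" and V: "?V = cnj z\<^sub>2 *\<^sub>C q + bop_apply (adj B) q"
    using kernel by (simp_all add: p_def q_def)
  have vA: "v = cnj z\<^sub>1 *\<^sub>C p - bop_apply (adj A) p" and vB: "v = cnj z\<^sub>2 *\<^sub>C q - bop_apply (adj B) q"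
    using vector z by (simp_all add: p_def q_def)
  have 1: "cinner (bop_apply X ?V) ?U + cinner (bop_apply X v) v
      = 2 * (c * cinner (bop_apply X q) p + cinner (bop_apply ?P q) p)"
  proof -
    have "cinner (bop_apply X v) v = cinner (bop_apply X (cnj z\<^sub>2 *\<^sub>C q - bop_apply (adj B) q)) (cnj z\<^sub>1 *\<^sub>C p - bop_apply (adj A) p)"
      using vA vB by simp
    then show ?thesis
      by (simp add: U V c_def bop_apply_linear cinner_linear cinner_adj algebra_simps)
  qed
  have 2: "cinner (bop_apply X ?U) ?V + cinner (bop_apply X v) v
      = 2 * (cnj c * cinner (bop_apply X p) q + cinner (bop_apply ?Q p) q)"
  proof -
    have "cinner (bop_apply X v) v = cinner (bop_apply X (cnj z\<^sub>1 *\<^sub>C p - bop_apply (adj A) p)) (cnj z\<^sub>2 *\<^sub>C q - bop_apply (adj B) q)"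
      using vA vB by simp
    then show ?thesis
      by (simp add: U V c_def bop_apply_linear cinner_linear cinner_adj algebra_simps)
  qed
  have c1: "cmod c \<le> 1"
    using z(3,4) by (simp add: c_def norm_mult mult_le_one)
  have "cmod (c * cinner (bop_apply X q) p + s * (cnj c * cinner (bop_apply X p) q))
      \<le> 2 * cmod c * numerical_radius X * ?n"
    using s cinner_phased_symmetrized_bound [of c X q p] cinner_phased_antisymmetrized_bound [of c X q p]
    by auto
  also have "\<dots> \<le> 2 * 1 * numerical_radius X * ?n"
    using c1 numerical_radius_nonneg [of X] by (intro mult_right_mono mult_left_mono) auto
  finally have X_part: "cmod (c * cinner (bop_apply X q) p + s * (cnj c * cinner (bop_apply X p) q)) \<le> 2 * numerical_radius X * ?n"
    by simp
  note PQ_part = cinner_cross_bound [OF s, of ?P q p ?Q]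
  let ?M = "2 * numerical_radius X + numerical_radius (?P + ?Q) + numerical_radius (?P - ?Q)"
  have M: "?M \<ge> 0" using numerical_radius_nonneg by (intro add_nonneg_nonneg mult_nonneg_nonneg) auto
  have "cinner (bop_apply X ?V) ?U + s * cinner (bop_apply X ?U) ?V + (1 + s) * cinner (bop_apply X v) v
      = (cinner (bop_apply X ?V) ?U + cinner (bop_apply X v) v) + s * (cinner (bop_apply X ?U) ?V + cinner (bop_apply X v) v)"
    by (simp add: algebra_simps)
  also have "\<dots> = 2 * ((c * cinner (bop_apply X q) p + s * (cnj c * cinner (bop_apply X p) q))
      + (cinner (bop_apply ?P q) p + s * cinner (bop_apply ?Q p) q))"
    unfolding 1 2 by (simp only: algebra_simps)
  finally have "cmod (cinner (bop_apply X ?V) ?U + s * cinner (bop_apply X ?U) ?V + (1 + s) * cinner (bop_apply X v) v)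
      = 2 * cmod ((c * cinner (bop_apply X q) p + s * (cnj c * cinner (bop_apply X p) q))
      + (cinner (bop_apply ?P q) p + s * cinner (bop_apply ?Q p) q))"
    by (simp only: norm_mult norm_numeral)
  also have "\<dots> \<le> 2 * (2 * numerical_radius X * ?n + (numerical_radius (?P + ?Q) + numerical_radius (?P - ?Q)) * ?n)"
    by (intro mult_left_mono norm_triangle_le add_mono X_part PQ_part) simp
  also have "\<dots> = 2 * ?n * ?M" by (simp add: algebra_simps)
  also have "\<dots> \<le> 2 * (a * b) * ?M"
  proof (intro mult_right_mono mult_left_mono M)
    have "norm p \<le> a" "norm q \<le> b"
      using norm_adj_apply [of "resolvent A z\<^sub>1" v] norm_adj_apply [of "resolvent B z\<^sub>2" v] res v
      by (simp_all add: p_def q_def)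
    then show "?n \<le> a * b" by (intro mult_mono) (auto intro: order_trans [OF norm_ge_zero])
  qed simp
  finally show ?thesis .
qed

lemma G1_resolvent_bound_inner_circle:
  fixes T :: "'a::chilbert_space bop"
  assumes T: "G1_operator T" "spectrum T \<noteq> {}" and r: "0 < r" "r < 1" "0 < dist_circle T - (1 - r)" and z: "cmod z = r"
  shows "z \<notin> spectrum T" and "norm (resolvent T z) \<le> 1 / (dist_circle T - (1 - r))"
proof -
  have d: "dist_circle T - (1 - r) \<le> dist z \<sigma>" if "\<sigma> \<in> spectrum T" for \<sigma>
  proof -
    \<comment> \<open>The radial projection of \<open>z\<close> to the unit circle, at distance \<open>1 - r\<close>.\<close>
    define e where "e = z / of_real r"
    have "cmod e = 1" using z r by (simp add: e_def norm_divide)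
    then have "dist_circle T \<le> dist e \<sigma>"
      unfolding dist_circle_def using that by (intro setdist_le_dist) auto
    also have "\<dots> \<le> dist e z + dist z \<sigma>" by (rule dist_triangle)
    also have "dist e z = 1 - r"
    proof -
      have "e - z = of_real (1 - r) * e" using r by (simp add: e_def field_simps)
      then have "cmod (e - z) = \<bar>1 - r\<bar> * cmod e" by (metis norm_mult norm_of_real)
      then show ?thesis using \<open>cmod e = 1\<close> r by (simp add: dist_norm)
    qed
    finally show ?thesis by simp
  qed
  from G1_norm_resolvent_le [OF T r(3) d]
  show "z \<notin> spectrum T" and "norm (resolvent T z) \<le> 1 / (dist_circle T - (1 - r))" by simp_all
qed

lemma dist_circle_pos:
  fixes T :: "'a::chilbert_space bop"
  assumes "G1_operator T" "(1 :: 'a bop) \<noteq> 0" "spectrum T \<subseteq> unit_disc"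
  shows "0 < dist_circle T"
proof -
  have "setdist (sphere 0 1) (spectrum T) > 0"
    using assms G1_spectrum_nonempty [OF assms(1,2)] G1_closed_spectrum [OF assms(1,2)]
    by (subst setdist_gt_0_compact_closed) auto
  then show ?thesis by (simp add: dist_circle_def)
qed

text \<open>
  For each \<open>r < 1\<close> close to \<open>1\<close>, the bound for kernels on the circle of radius \<open>r\<close> is averaged first over the
  kernels of \<open>A\<close> and then over those of \<open>B\<close>; the constant then depends on \<open>r\<close> continuously up to \<open>r = 1\<close>.
\<close>

lemma calculus_form_bound:
  fixes A B X :: "'a::chilbert_space bop"
  assumes A: "G1_operator A" "spectrum A \<subseteq> unit_disc" and B: "G1_operator B" "spectrum B \<subseteq> unit_disc"
    and nontrivial: "(1 :: 'a bop) \<noteq> 0" and f: "f \<in> class_A"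
    and s: "s = 1 \<or> s = (- 1 :: complex)" and v: "norm v = 1"
  shows "cmod (cinner (bop_apply X (bop_apply (conj_calculus f B) v)) (bop_apply (conj_calculus f A) v)
      + s * cinner (bop_apply X (bop_apply (conj_calculus f A) v)) (bop_apply (conj_calculus f B) v)
      + (1 + s) * cinner (bop_apply X v) v)
    \<le> 2 / (dist_circle A * dist_circle B) *
           (2 * numerical_radius X + numerical_radius (A * X * adj B + B * X * adj A)
             + numerical_radius (A * X * adj B - B * X * adj A))"
    (is "?lhs \<le> 2 / (?dA * ?dB) * ?M")
proof -
  obtain rA where rA: "0 < rA" "rA < 1" "\<And>r x y. rA < r \<Longrightarrow> r < 1 \<Longrightarrow>
      ((\<lambda>t. of_real (Re (f (circlepath 0 r t))) * cinner (bop_apply (herglotz_kernel A (circlepath 0 r t)) x) y)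
        has_integral cinner (bop_apply (disc_calculus f A) x) y) {0..1}"
    using disc_calculus_average [OF A(1) nontrivial A(2) f] by blast
  obtain rB where rB: "0 < rB" "rB < 1" "\<And>r x y. rB < r \<Longrightarrow> r < 1 \<Longrightarrow>
      ((\<lambda>t. of_real (Re (f (circlepath 0 r t))) * cinner (bop_apply (herglotz_kernel B (circlepath 0 r t)) x) y)
        has_integral cinner (bop_apply (disc_calculus f B) x) y) {0..1}"
    using disc_calculus_average [OF B(1) nontrivial B(2) f] by blast
  have dA: "0 < ?dA" and dB: "0 < ?dB"
    using dist_circle_pos nontrivial A B by auto
  define r\<^sub>0 where "r\<^sub>0 = max (max rA rB) (max (1 - ?dA) (1 - ?dB))"
  have r\<^sub>0: "r\<^sub>0 < 1" using rA rB dA dB by (simp add: r\<^sub>0_def)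
  have "?lhs \<le> 2 * (1 / (?dA - (1 - r)) * (1 / (?dB - (1 - r)))) * ?M" (is "_ \<le> ?C") if r: "r\<^sub>0 < r" "r < 1" for r
  proof -
    let ?c = "circlepath 0 r"
    have r': "0 < r" "rA < r" "rB < r" "0 < ?dA - (1 - r)" "0 < ?dB - (1 - r)"
      using r rA(1) by (auto simp: r\<^sub>0_def)
    have c_norm: "cmod (?c t) = r" for t using r' by (simp add: circlepath norm_mult)
    have kernels: "cmod (cinner (bop_apply X (bop_apply (adj (herglotz_kernel B (?c u))) v)) (bop_apply (adj (herglotz_kernel A (?c t))) v)
      + s * cinner (bop_apply X (bop_apply (adj (herglotz_kernel A (?c t))) v)) (bop_apply (adj (herglotz_kernel B (?c u))) v)
      + (1 + s) * cinner (bop_apply X v) v) \<le> ?C" for t u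
      using G1_resolvent_bound_inner_circle [OF A(1) G1_spectrum_nonempty [OF A(1) nontrivial] r'(1) r(2) r'(4) c_norm]
        G1_resolvent_bound_inner_circle [OF B(1) G1_spectrum_nonempty [OF B(1) nontrivial] r'(1) r(2) r'(5) c_norm]
        c_norm r s v
      by (intro herglotz_kernel_form_bound) auto
    let ?p = "\<lambda>t. Re (f (?c t))"
    have p1: "(?p has_integral 1) {0..1}" by (rule class_A_mean_Re [OF f r'(1) r(2)])
    have p0: "0 \<le> ?p t" for t
      using f c_norm [of t] r by (auto simp: class_A_def intro!: less_imp_le)
    have "cmod (cinner (bop_apply X (bop_apply (adj (herglotz_kernel B (?c u))) v)) (bop_apply (conj_calculus f A) v)
      + s * cinner (bop_apply X (bop_apply (conj_calculus f A) v)) (bop_apply (adj (herglotz_kernel B (?c u))) v)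
      + (1 + s) * cinner (bop_apply X v) v) \<le> ?C" for u
      unfolding conj_calculus_def
      by (rule sesquilinear_average_bound [OF rA(3) p1 p0 kernels]) (use r r' in auto)
    \<comment> \<open>The averaged operator has to stand on the right in the first summand; multiplying by \<open>s = s\<^sup>-\<^sup>1\<close> exchanges the two.\<close>
    moreover have flip: "cmod (x + s * y + (1 + s) * z) = cmod (y + s * x + (1 + s) * z)" for x y z
      using s by (auto simp: norm_minus_commute add_ac)
    ultimately have "cmod (cinner (bop_apply X (bop_apply (conj_calculus f A) v)) (bop_apply (adj (herglotz_kernel B (?c u))) v)
      + s * cinner (bop_apply X (bop_apply (adj (herglotz_kernel B (?c u))) v)) (bop_apply (conj_calculus f A) v)
      + (1 + s) * cinner (bop_apply X v) v) \<le> ?C" for u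
      by (subst flip)
    from sesquilinear_average_bound [OF rB(3) p1 p0 this]
    have "cmod (cinner (bop_apply X (bop_apply (conj_calculus f A) v)) (bop_apply (conj_calculus f B) v)
      + s * cinner (bop_apply X (bop_apply (conj_calculus f B) v)) (bop_apply (conj_calculus f A) v)
      + (1 + s) * cinner (bop_apply X v) v) \<le> ?C"
      using r r' by (simp add: conj_calculus_def)
    then show ?thesis by (subst flip)
  qed
  then have "\<forall>\<^sub>F r in at_left 1. ?lhs \<le> 2 * (1 / (?dA - (1 - r)) * (1 / (?dB - (1 - r)))) * ?M"
    using eventually_at_left_real [OF r\<^sub>0] by (auto elim!: eventually_mono)
  moreover have "((\<lambda>r. 2 * (1 / (?dA - (1 - r)) * (1 / (?dB - (1 - r)))) * ?M)
      \<longlongrightarrow> 2 * (1 / (?dA - (1 - 1)) * (1 / (?dB - (1 - 1)))) * ?M) (at_left 1)"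
    using dA dB by (intro tendsto_intros) auto
  ultimately have "?lhs \<le> 2 * (1 / (?dA - (1 - 1)) * (1 / (?dB - (1 - 1)))) * ?M"
    by (intro tendsto_lowerbound) auto
  then show ?thesis by simp
qed

theorem theorem2p4:
  fixes A B X :: "'a::chilbert_space bop" and f :: "complex \<Rightarrow> complex"
  assumes "G1_operator A" and "G1_operator B"
    and "spectrum A \<union> spectrum B \<subseteq> unit_disc"
    and "f \<in> class_A"
  shows "numerical_radius
           (disc_calculus f A * X * conj_calculus f B - disc_calculus f B * X * conj_calculus f A)
         \<le> 2 / (dist_circle A * dist_circle B) *
           (2 * numerical_radius X + numerical_radius (A * X * adj B + B * X * adj A)
             + numerical_radius (A * X * adj B - B * X * adj A))
       \<and> numerical_radius
           (disc_calculus f A * X * conj_calculus f B + 2 *\<^sub>R X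
             + disc_calculus f B * X * conj_calculus f A)
         \<le> 2 / (dist_circle A * dist_circle B) *
           (2 * numerical_radius X + numerical_radius (A * X * adj B + B * X * adj A)
             + numerical_radius (A * X * adj B - B * X * adj A))"
    (is "_ \<le> ?C \<and> _")
proof -
  have C: "0 \<le> ?C"
    using numerical_radius_nonneg unfolding dist_circle_def
    by (intro mult_nonneg_nonneg add_nonneg_nonneg divide_nonneg_nonneg setdist_pos_le) auto
  have bound: "cmod (cinner (bop_apply X (bop_apply (conj_calculus f B) v)) (bop_apply (conj_calculus f A) v)
      + s * cinner (bop_apply X (bop_apply (conj_calculus f A) v)) (bop_apply (conj_calculus f B) v)
      + (1 + s) * cinner (bop_apply X v) v) \<le> ?C"
    if "norm v = 1" "s = 1 \<or> s = (- 1 :: complex)" for v s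
  proof (rule calculus_form_bound)
    \<comment> \<open>A unit vector exists, so the space is not zero.\<close>
    show "(1 :: 'a bop) \<noteq> 0"
    proof
      assume "(1 :: 'a bop) = 0"
      then have "bop_apply 1 v = bop_apply 0 v" by simp
      then show False using that(1) by simp
    qed
  qed (use assms that in auto)
  have form: "cinner (bop_apply (disc_calculus f S * X * conj_calculus f T) v) v
      = cinner (bop_apply X (bop_apply (conj_calculus f T) v)) (bop_apply (conj_calculus f S) v)"
    for S T :: "'a bop" and v
    by (simp add: conj_calculus_def cinner_adj)
  show ?thesis
  proof (intro conjI numerical_radius_leI C)
    fix v :: 'a assume v: "norm v = 1"
    show "cmod (cinner (bop_apply (disc_calculus f A * X * conj_calculus f B
        - disc_calculus f B * X * conj_calculus f A) v) v) \<le> ?C"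
      using bound [OF v, of "- 1"] by (simp add: cinner_linear form [simplified])
    show "cmod (cinner (bop_apply (disc_calculus f A * X * conj_calculus f B + 2 *\<^sub>R X
        + disc_calculus f B * X * conj_calculus f A) v) v) \<le> ?C"
      using bound [OF v, of 1] by (simp add: cinner_linear form [simplified] add_ac)
  qed
qed

end
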